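(* Let $q$ be a prime power, $n\ge 1$ and $r\ge 2$ integers, and let $V$ be an $r$-dimensional $\mathbb{F}_{q^n}$-vector space. Let $U$ be an $\mathbb{F}_q$-subspace of $V$ of dimension $m$ over $\mathbb{F}_q$, where $n\mid m$ and $1\le m\le (r-1)n$, such that there is no hyperplane of $V$ (i.e. $(r-1)$-dimensional $\mathbb{F}_{q^n}$-subspace) meeting $U$ in an $\mathbb{F}_q$-subspace of dimension $m-n+1$. Let $d$ be defined by $$m-n+d=\min\{\dim_{\mathbb{F}_q}(U\cap H) : H \text{ a hyperplane of } V,\ \dim_{\mathbb{F}_q}(U\cap H)>m-n\}.$$ Then $d\mid n$ and $U$ is $\mathbb{F}_{q^d}$-linear, i.e. $U$ is an $\mathbb{F}_{q^d}$-subspace of $V$.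
   Context: Every hyperplane $H$ of $V$ satisfies $\dim_{\mathbb{F}_q}(U\cap H)\ge m-n$. *)

theory Defs
  imports
    "HOL-Algebra.Algebraic_Closure_Type"
    "HOL-Number_Theory.Prime_Powers"
    "HOL-Library.Cardinality"
begin

text \<open>
  A type \<open>'k\<close> is regarded as a subfield of \<open>'a\<close> through an embedding \<open>h\<close>, and an
  \<open>'a\<close>-vector space then becomes a \<open>'k\<close>-vector space with the scalar multiplication below.
  Dimensions and subspaces over \<open>'k\<close> are the library notions for that multiplication.
\<close>

definition restrict_scalars ::
    "('k \<Rightarrow> 'a) \<Rightarrow> ('a \<Rightarrow> 'v \<Rightarrow> 'v) \<Rightarrow> 'k \<Rightarrow> 'v \<Rightarrow> 'v" where
  "restrict_scalars h scale = (\<lambda>c v. scale (h c) v)"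

text \<open>
  Since \<open>dim\<close> is 0 for spaces without a finite basis, this is only meaningful for
  finite-dimensional spaces of dimension at least 1.
\<close>

definition hyperplane :: "('a::field \<Rightarrow> 'v::ab_group_add \<Rightarrow> 'v) \<Rightarrow> 'v set \<Rightarrow> bool" where
  "hyperplane scale H \<longleftrightarrow>
     module.subspace scale H \<and>
     vector_space.dim scale H = vector_space.dim scale UNIV - 1"

text \<open>
  Subspaces over a subfield \<open>L\<close> given as a subset of \<open>'a\<close>, needed where the order of the
  subfield is not determined by a type.
\<close>

definition subspace_over ::
    "'a set \<Rightarrow> ('a \<Rightarrow> 'v::ab_group_add \<Rightarrow> 'v) \<Rightarrow> 'v set \<Rightarrow> bool" where
  "subspace_over L scale U \<longleftrightarrow>
     0 \<in> U \<and> (\<forall>x\<in>U. \<forall>y\<in>U. x + y \<in> U) \<and> (\<forall>c\<in>L. \<forall>x\<in>U. scale c x \<in> U)"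

end

theory Submission
  imports Defs
begin

text \<open>
  Write \<open>F\<close> for the field with \<open>Q = q ^ n\<close> elements and \<open>p\<close> for its characteristic. Hyperplanes
  of \<open>V\<close> are the kernels of the nonzero linear functionals \<open>\<mu>\<close>, and \<open>U \<inter> ker \<mu>\<close> is the kernel of
  \<open>\<mu>\<close> on \<open>U\<close>. Hence the minimality of \<open>d\<close> says that \<open>\<mu> ` U\<close> is either all of \<open>F\<close> or has at most
  \<open>Q / s\<close> elements, where \<open>s = q ^ d\<close>. From this one has to find many scalars \<open>l\<close> with
  \<open>l U \<subseteq> U\<close>.

  Since \<open>n\<close> divides \<open>m\<close>, the order of \<open>U\<close> is a power of \<open>Q\<close>, and a count gives an \<open>F\<close>-subspace
  \<open>C\<close> with \<open>V = U \<oplus> C\<close> as additive groups. Let \<open>\<rho>\<close> be the projection onto \<open>C\<close> along \<open>U\<close>. It is only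
  additive, and \<open>l U \<subseteq> U\<close> as soon as \<open>\<rho>\<close> commutes with \<open>l\<close>. So for a vector \<open>v\<close> and a functional
  \<open>\<mu>\<close> consider the additive map \<open>f(t) = \<mu>(\<rho>(t v))\<close> of \<open>F\<close> into itself. Trace duality turns the
  hypothesis on images into one on kernels (\<open>eigen_kernel_bound\<close>): for every scalar \<open>a\<close> the set of
  all \<open>t\<close> with \<open>f(t) = a t\<close> is \<open>{0}\<close> or has at least \<open>s\<close> elements.

  The core is the theorem \<open>additive_map_semilinear\<close>: such an \<open>f\<close> is linear over the subfield of
  all \<open>l\<close> with \<open>l ^ (p ^ D) = l\<close>, for some divisor \<open>D\<close> of the degree of \<open>F\<close> with \<open>p ^ D \<ge> s\<close>.
  In geometric terms: if every line that joins two points of the graph of an additive function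
  contains at least \<open>s\<close> points of it, then the function is linear over a field of order at least \<open>s\<close>.
  The proof uses the Redei polynomial \<open>R(X, Y)\<close>, the product of \<open>X - f(x) + x Y\<close> over all \<open>x\<close> in
  \<open>F\<close>. As a product over an additive group, it is a sum of terms \<open>A\<^sub>i(Y) X ^ (p ^ i)\<close>. At \<open>Y = y\<close> it is \<open>X ^ Q - X\<close>
  if \<open>f - y\<close> is injective, and otherwise a power whose exponent is the order of the kernel of \<open>f - y\<close>,
  which is a power of \<open>p\<close> not below \<open>s\<close>. So \<open>A\<^sub>i\<close> with \<open>1 < p ^ i < s\<close> vanishes at all
  points of \<open>F\<close>, and then identically by its degree. On the other hand, the root \<open>f(x) - x Y\<close> of \<open>R\<close>
  yields a recursion between the \<open>A\<^sub>i\<close> in which the coefficients of \<open>f\<close> occur. The nonzero \<open>A\<^sub>i\<close>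
  have pairwise distinct degrees, so nothing can cancel in this recursion, and the indices of nonzero
  \<open>A\<^sub>i\<close> are closed under adding the \<open>t\<close> with \<open>x ^ (p ^ t)\<close> in \<open>f\<close>, modulo the degree of \<open>F\<close>. The
  greatest common divisor \<open>D\<close> of this degree and of all these \<open>t\<close> is therefore such an index or the
  degree itself, whence \<open>p ^ D \<ge> s\<close>.

  The exponent \<open>D\<close> depends on \<open>v\<close> and \<open>\<mu>\<close> so far. For a fixed \<open>D\<close> the good vectors, and for a fixed
  vector the good functionals, form subspaces; there are fewer possible \<open>D\<close> than elements of \<open>F\<close>,
  and a vector space over \<open>F\<close> is not a union of so few proper subspaces. Hence one \<open>D\<close> serves for all
  (\<open>uniform_semilinear\<close>), and the field \<open>L\<close> of all \<open>l\<close> with \<open>l U \<subseteq> U\<close> has at least \<open>q ^ d\<close>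
  elements. It contains the field with \<open>q\<close> elements, so it has order \<open>q ^ e\<close> with \<open>e \<ge> d\<close>. Finally
  \<open>F\<close>, \<open>U\<close> and the section \<open>U \<inter> H\<close> by a hyperplane that attains the minimum are spaces over
  \<open>L\<close>, so \<open>e\<close> divides \<open>n\<close>, \<open>m\<close> and \<open>m - n + d\<close>. Thus \<open>e\<close> divides \<open>d\<close>, and \<open>e = d\<close>.
\<close>

section \<open>Chains of subspaces over a subfield\<close>

text \<open>
  Subfields are sets here because the fields of linearity that occur in the proof are
  determined by the data, and several of them act on one space.
\<close>

definition subfield_set :: "'a::field set \<Rightarrow> bool" where
  "subfield_set L \<longleftrightarrow> 0 \<in> L \<and> 1 \<in> L \<and> (\<forall>x\<in>L. \<forall>y\<in>L. x + y \<in> L \<and> x * y \<in> L)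
     \<and> (\<forall>x\<in>L. - x \<in> L \<and> inverse x \<in> L)"

text \<open>
  Translation and multiplication by a nonzero element are injective self-maps of the finite set
  \<open>L\<close>, hence onto, and so they reach \<open>0\<close> and \<open>1\<close>.
\<close>

lemma subfield_setI_finite:
  fixes L :: "'a::{field,finite} set"
  assumes "0 \<in> L" "1 \<in> L"
    and add: "\<And>x y. x \<in> L \<Longrightarrow> y \<in> L \<Longrightarrow> x + y \<in> L"
    and mult: "\<And>x y. x \<in> L \<Longrightarrow> y \<in> L \<Longrightarrow> x * y \<in> L"
  shows "subfield_set L"
proof -
  have "- x \<in> L" if x: "x \<in> L" for x
  proof -
    have "(\<lambda>y. x + y) ` L = L"
      using x add by (intro endo_inj_surj) (auto simp: inj_on_def)
    then obtain y where "y \<in> L" "x + y = 0"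
      using assms(1) by (metis (no_types, lifting) imageE)
    then show ?thesis by (metis neg_eq_iff_add_eq_0)
  qed
  moreover have "inverse x \<in> L" if x: "x \<in> L" for x
  proof (cases "x = 0")
    case False
    have "(\<lambda>y. x * y) ` L = L"
      using x mult False by (intro endo_inj_surj) (auto simp: inj_on_def)
    then obtain y where "y \<in> L" "x * y = 1"
      using assms(2) by (metis (no_types, lifting) imageE)
    then show ?thesis by (metis inverse_unique)
  qed (use assms in auto)
  ultimately show ?thesis using assms by (auto simp: subfield_set_def)
qed

lemma vector_space_field: "vector_space ((*) :: 'a::field \<Rightarrow> 'a \<Rightarrow> 'a)"
  by unfold_locales (auto simp: algebra_simps)

definition adjoin :: "'a set \<Rightarrow> ('a \<Rightarrow> 'v::ab_group_add \<Rightarrow> 'v) \<Rightarrow> 'v set \<Rightarrow> 'v \<Rightarrow> 'v set" where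
  "adjoin L scale H g = (\<lambda>(x, l). x + scale l g) ` (H \<times> L)"

lemma subspace_over_diff:
  assumes "vector_space scale" "subfield_set L" "subspace_over L scale H" "x \<in> H" "y \<in> H"
  shows "x - y \<in> H"
proof -
  interpret vector_space scale by fact
  have "- 1 \<in> L" using assms(2) by (auto simp: subfield_set_def)
  then have "scale (- 1) y \<in> H" using assms(3,5) unfolding subspace_over_def by blast
  then have "x + scale (-1) y \<in> H" using assms unfolding subspace_over_def by blast
  then show ?thesis by simp
qed

lemma inj_on_adjoin:
  assumes "vector_space scale" "subfield_set L" "subspace_over L scale H" "g \<notin> H"
  shows "inj_on (\<lambda>(x, l). x + scale l g) (H \<times> L)"
proof -
  interpret vector_space scale by fact
  have "x = y \<and> l = k"
    if *: "x \<in> H" "l \<in> L" "y \<in> H" "k \<in> L" "x + scale l g = y + scale k g" for x y l k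
  proof -
    have "l = k"
    proof (rule ccontr)
      assume "l \<noteq> k"
      have "scale (l - k) g = y - x" using *(5) by (simp add: algebra_simps)
      then have "scale (l - k) g \<in> H" using subspace_over_diff[OF assms(1-3) *(3,1)] by simp
      moreover have "inverse (l - k) \<in> L"
        using * assms(2) by (metis subfield_set_def add_uminus_conv_diff)
      ultimately have "scale (inverse (l - k)) (scale (l - k) g) \<in> H"
        using assms(3) unfolding subspace_over_def by blast
      with \<open>l \<noteq> k\<close> assms(4) show False by simp
    qed
    with * show ?thesis by simp
  qed
  then show ?thesis by (auto simp: inj_on_def)
qed

lemma subspace_over_adjoin:
  assumes "vector_space scale" "subfield_set L" "subspace_over L scale H"
  shows "subspace_over L scale (adjoin L scale H g)"
proof -
  interpret vector_space scale by fact
  show ?thesis unfolding subspace_over_def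
  proof (intro conjI ballI)
    show "0 \<in> adjoin L scale H g"
      using assms by (force simp: adjoin_def subspace_over_def subfield_set_def image_iff)
  next
    fix u v assume "u \<in> adjoin L scale H g" "v \<in> adjoin L scale H g"
    then obtain x l y k where "x \<in> H" "l \<in> L" "y \<in> H" "k \<in> L"
      and *: "u = x + scale l g" "v = y + scale k g" by (auto simp: adjoin_def)
    then have "(x + y, l + k) \<in> H \<times> L"
      using assms by (auto simp: subspace_over_def subfield_set_def)
    then show "u + v \<in> adjoin L scale H g"
      unfolding adjoin_def by (rule rev_image_eqI) (simp add: * algebra_simps)
  next
    fix c u assume "c \<in> L" "u \<in> adjoin L scale H g"
    then obtain x l where "x \<in> H" "l \<in> L" and *: "u = x + scale l g" by (auto simp: adjoin_def)
    then have "(scale c x, c * l) \<in> H \<times> L"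
      using assms \<open>c \<in> L\<close> by (auto simp: subspace_over_def subfield_set_def)
    then show "scale c u \<in> adjoin L scale H g"
      unfolding adjoin_def by (rule rev_image_eqI) (simp add: * algebra_simps)
  qed
qed

lemma adjoin_superset:
  assumes "vector_space scale" "subfield_set L" "subspace_over L scale H"
  shows "H \<subseteq> adjoin L scale H g" "g \<in> adjoin L scale H g"
proof -
  interpret vector_space scale by fact
  have "(x, 0) \<in> H \<times> L" if "x \<in> H" for x using assms(2) that by (auto simp: subfield_set_def)
  then show "H \<subseteq> adjoin L scale H g" unfolding adjoin_def by (auto intro!: rev_image_eqI)
  have "(0, 1) \<in> H \<times> L" using assms by (auto simp: subfield_set_def subspace_over_def)
  then show "g \<in> adjoin L scale H g" unfolding adjoin_def by (rule rev_image_eqI) simp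
qed

lemma adjoin_least:
  assumes "subspace_over L scale S" "H \<subseteq> S" "g \<in> S"
  shows "adjoin L scale H g \<subseteq> S"
  using assms by (auto simp: adjoin_def subspace_over_def)

lemma card_adjoin:
  assumes "vector_space scale" "subfield_set L" "subspace_over L scale H" "g \<notin> H"
  shows "card (adjoin L scale H g) = card H * card L"
  unfolding adjoin_def using card_image[OF inj_on_adjoin[OF assms]]
  by (simp add: card_cartesian_product)

text \<open>
  Every finite \<open>L\<close>-subspace is reached from \<open>{0}\<close> by adjoining one vector at a time; a maximal
  subspace of \<open>S\<close> with the property \<open>P\<close> must be \<open>S\<close>. This replaces bases in all arguments about
  additive groups below, where \<open>L\<close> is the prime field.
\<close>

lemma subspace_over_induct:
  assumes vs: "vector_space scale" and L: "subfield_set L"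
    and S: "subspace_over L scale S" "finite S"
    and base: "P {0}"
    and step: "\<And>H g. subspace_over L scale H \<Longrightarrow> finite H \<Longrightarrow> g \<notin> H \<Longrightarrow> P H \<Longrightarrow> P (adjoin L scale H g)"
  shows "P S"
proof -
  interpret vector_space scale by fact
  define F where "F = {H. H \<subseteq> S \<and> subspace_over L scale H \<and> P H}"
  have "{0} \<in> F" using base S by (auto simp: F_def subspace_over_def)
  moreover have "finite F" using S(2) by (auto simp: F_def)
  ultimately obtain H where H: "H \<in> F" "\<And>H'. H' \<in> F \<Longrightarrow> H \<subseteq> H' \<Longrightarrow> H = H'"
    using finite_has_maximal2 by metis
  have "S \<subseteq> H"
  proof (rule ccontr)
    assume "\<not> S \<subseteq> H"
    then obtain g where g: "g \<in> S" "g \<notin> H" by auto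
    have "adjoin L scale H g \<in> F"
      using H(1) g S subspace_over_adjoin[OF vs L] adjoin_least[OF S(1)] step
      by (auto simp: F_def finite_subset)
    then show False
      using H adjoin_superset[OF vs L, of H g] g(2) by (auto simp: F_def)
  qed
  then show ?thesis using H(1) by (auto simp: F_def)
qed

lemma card_subspace_over_power:
  assumes "vector_space scale" "subfield_set L" "subspace_over L scale S" "finite S"
  shows "\<exists>e. card S = card L ^ e"
  using assms(3,4)
proof (induction rule: subspace_over_induct[OF assms, consumes 0])
  case 1
  show ?case by (auto intro: exI[of _ 0])
next
  case (2 H g)
  then obtain e where "card H = card L ^ e" by auto
  then have "card (adjoin L scale H g) = card L ^ Suc e"
    using card_adjoin[OF assms(1,2)] 2 by simp
  then show ?case by blast
qed

section \<open>Linearized polynomials\<close>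

lemma one_less_CARD_field: "CARD('a::{field,finite}) > 1"
  using card_mono[of "UNIV :: 'a set" "{0, 1}"] by simp

lemma prime_CHAR_finite: "prime (CHAR('a::{field,finite}))"
  using prime_CHAR_semidom[where ?'a = 'a] finite_imp_CHAR_pos[where ?'a = 'a] by simp

definition prime_subfield :: "'a::{field,finite} set" where
  "prime_subfield = range of_nat"

lemma prime_subfield_eq: "(prime_subfield :: 'a::{field,finite} set) = of_nat ` {..<CHAR('a)}"
proof -
  have "(of_nat n :: 'a) \<in> of_nat ` {..<CHAR('a)}" for n
  proof (rule rev_image_eqI)
    show "n mod CHAR('a) \<in> {..<CHAR('a)}"
      using prime_gt_0_nat[OF prime_CHAR_finite[where ?'a = 'a]] by simp
    have "(of_nat n :: 'a) = of_nat (CHAR('a) * (n div CHAR('a)) + n mod CHAR('a))" by simp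
    also have "\<dots> = of_nat (n mod CHAR('a))" by (simp only: of_nat_add of_nat_mult of_nat_CHAR mult_zero_left add_0)
    finally show "(of_nat n :: 'a) = of_nat (n mod CHAR('a))" .
  qed
  then show ?thesis by (auto simp: prime_subfield_def)
qed

lemma inj_on_of_nat_CHAR: "inj_on (of_nat :: nat \<Rightarrow> 'a::idom) {..<CHAR('a)}"
proof -
  have "i = j" if "i < CHAR('a)" "j \<le> i" "(of_nat i :: 'a) = of_nat j" for i j
  proof -
    have "of_nat (i - j) = (0 :: 'a)" using that by (simp add: of_nat_diff)
    then have "CHAR('a) dvd i - j" by (simp add: of_nat_eq_0_iff_char_dvd)
    then show ?thesis using that nat_dvd_not_less[of "i - j" "CHAR('a)"] by linarith
  qed
  then show ?thesis unfolding inj_on_def by (metis lessThan_iff nle_le)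
qed

lemma subfield_prime_subfield: "subfield_set (prime_subfield :: 'a::{field,finite} set)"
  by (rule subfield_setI_finite)
    (force simp: prime_subfield_def image_iff simp flip: of_nat_add of_nat_mult
      intro: exI[of _ 0] exI[of _ 1])+

lemma card_prime_subfield: "card (prime_subfield :: 'a::{field,finite} set) = CHAR('a)"
  unfolding prime_subfield_eq by (simp add: card_image inj_on_of_nat_CHAR)

lemma power_CHAR_of_nat:
  assumes "prime (CHAR('k::comm_semiring_1))"
  shows "(of_nat k :: 'k) ^ CHAR('k) = of_nat k"
proof (induction k)
  case 0
  then show ?case using prime_gt_0_nat[OF assms] by (simp add: power_0_left)
next
  case (Suc k)
  then show ?case using freshmans_dream[OF assms refl, of 1 "of_nat k"] by simp
qed

text \<open>
  Both sides are monic of degree \<open>p\<close> in \<open>Z\<close>, and by Fermat's little theorem they share the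
  \<open>p\<close> distinct roots \<open>k W\<close> if \<open>W\<close> is nonzero.
\<close>

lemma prod_diff_of_nat_mult:
  fixes Z W :: "'k::idom"
  assumes p: "prime (CHAR('k))"
  shows "(\<Prod>k<CHAR('k). Z - of_nat k * W) = Z ^ CHAR('k) - W ^ (CHAR('k) - 1) * Z"
proof (cases "W = 0")
  case True
  then show ?thesis using prime_gt_1_nat[OF p] by (simp add: power_0_left)
next
  case False
  let ?p = "CHAR('k)"
  define T where "T = (\<Prod>k<?p. [:- (of_nat k * W), 1:])"
  define S where "S = monom 1 ?p + monom (- (W ^ (?p - 1))) 1"
  have p1: "?p > 1" using prime_gt_1_nat[OF p] .
  have dT: "degree T = ?p" unfolding T_def
    by (subst degree_prod_eq_sum_degree) auto
  have lT: "coeff T ?p = 1" unfolding dT[symmetric] unfolding T_def lead_coeff_prod by simp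
  have dS: "degree S = ?p" unfolding S_def
    using p1 by (subst degree_add_eq_left) (auto simp: degree_monom_eq
      intro: le_less_trans[OF degree_monom_le])
  have lS: "coeff S ?p = 1" using p1 by (simp add: S_def)
  have Wp: "W ^ ?p = W ^ (?p - 1) * W" using p1 by (metis power_minus_mult gr_implies_not0 neq0_conv)
  have "T = S"
  proof (rule poly_eqI_degree_lead_coeff[where A = "(\<lambda>k. of_nat k * W) ` {..<?p}" and n = ?p])
    show "poly T z = poly S z" if "z \<in> (\<lambda>k. of_nat k * W) ` {..<?p}" for z
    proof -
      from that obtain k where k: "k < ?p" "z = of_nat k * W" by auto
      have "poly T z = 0" unfolding T_def poly_prod using k by (auto intro!: prod_zero)
      moreover have "poly S z = 0"
        by (simp add: S_def poly_monom k power_mult_distrib power_CHAR_of_nat[OF p] Wp)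
      ultimately show ?thesis by simp
    qed
    show "?p \<le> card ((\<lambda>k. of_nat k * W) ` {..<?p})"
      using inj_on_of_nat_CHAR[where ?'a = 'k] False
      by (subst card_image) (auto simp: inj_on_def)
  qed (use dT dS lT lS in auto)
  then have "poly T Z = poly S Z" by simp
  then show ?thesis by (simp add: T_def S_def poly_prod poly_monom)
qed

definition linearized :: "'k::comm_ring_1 poly \<Rightarrow> bool" where
  "linearized P \<longleftrightarrow> (\<forall>k. coeff P k \<noteq> 0 \<longrightarrow> (\<exists>i. k = CHAR('k) ^ i))"

lemma linearized_0: "linearized 0"
  by (simp add: linearized_def)

lemma linearized_X: "linearized [:0, 1:]"
  by (auto simp: linearized_def coeff_pCons split: nat.splits intro: exI[of _ 0])

lemma linearized_add: "linearized P \<Longrightarrow> linearized R \<Longrightarrow> linearized (P + R)"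
  unfolding linearized_def by (metis coeff_add add.right_neutral)

lemma linearized_smult: "linearized P \<Longrightarrow> linearized (smult c P)"
  unfolding linearized_def by (metis coeff_smult mult_zero_right)

lemma poly_frobenius:
  fixes P :: "'k::comm_ring_1 poly"
  assumes p: "prime (CHAR('k))" and m: "m = CHAR('k) ^ w"
  shows "P ^ m = (\<Sum>k\<le>degree P. monom (coeff P k ^ m) (k * m))"
proof -
  have "P ^ m = (\<Sum>k\<le>degree P. monom (coeff P k) k) ^ m"
    by (simp add: poly_as_sum_of_monoms)
  also have "\<dots> = (\<Sum>k\<le>degree P. monom (coeff P k) k ^ m)"
    by (rule freshmans_dream_sum') (use p m in auto)
  finally show ?thesis by (simp add: monom_power)
qed

lemma linearized_power_CHAR:
  fixes P :: "'k::comm_ring_1 poly"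
  assumes p: "prime (CHAR('k))" and P: "linearized P"
  shows "linearized (P ^ CHAR('k))"
  unfolding linearized_def
proof (intro allI impI)
  fix k assume "coeff (P ^ CHAR('k)) k \<noteq> 0"
  then have "(\<Sum>j\<le>degree P. coeff (monom (coeff P j ^ CHAR('k)) (j * CHAR('k))) k) \<noteq> 0"
    using poly_frobenius[OF p, of "CHAR('k)" 1 P] by (simp add: coeff_sum)
  then obtain j where "coeff (monom (coeff P j ^ CHAR('k)) (j * CHAR('k))) k \<noteq> 0"
    by (meson sum.not_neutral_contains_not_neutral)
  then have *: "k = j * CHAR('k)" "coeff P j ^ CHAR('k) \<noteq> 0" by (auto split: if_splits)
  then have "coeff P j \<noteq> 0" using p by (metis power_0_left not_prime_0)
  then obtain i where "j = CHAR('k) ^ i" using P by (auto simp: linearized_def)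
  then have "k = CHAR('k) ^ Suc i" using * by simp
  then show "\<exists>i. k = CHAR('k) ^ i" by blast
qed

lemma linearized_poly_add:
  fixes P :: "'k::comm_ring_1 poly"
  assumes p: "prime (CHAR('k))" and P: "linearized P"
  shows "poly P (x + y) = poly P x + poly P y"
proof -
  have "coeff P k * (x + y) ^ k = coeff P k * x ^ k + coeff P k * y ^ k" for k
  proof (cases "coeff P k = 0")
    case False
    then obtain i where "k = CHAR('k) ^ i" using P by (auto simp: linearized_def)
    then show ?thesis using freshmans_dream'[OF p, of k i x y] by (simp add: algebra_simps)
  qed simp
  then show ?thesis by (simp add: poly_altdef sum.distrib)
qed

text \<open>
  Substitution is evaluation over the polynomial ring, which has the same characteristic, so
  this is the additivity of evaluation once more.
\<close>

lemma linearized_pcompose_add: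
  fixes P :: "'k::comm_ring_1 poly"
  assumes p: "prime (CHAR('k))" and P: "linearized P"
  shows "pcompose P (Q + R) = pcompose P Q + pcompose P R"
proof -
  have "linearized (map_poly (\<lambda>x. [:x:]) P)"
    using P by (auto simp: linearized_def coeff_map_poly)
  then show ?thesis unfolding pcompose_altdef
    by (intro linearized_poly_add) (use p in auto)
qed

lemma pcompose_const_right: "pcompose P [:c:] = [:poly P c:]"
  by (induction P) (auto simp: pcompose_pCons mult.commute)

lemma linearized_as_sum:
  fixes P :: "'k::comm_ring_1 poly"
  assumes p: "prime (CHAR('k))" and P: "linearized P" and deg: "degree P < CHAR('k) ^ N"
  shows "P = (\<Sum>i<N. monom (coeff P (CHAR('k) ^ i)) (CHAR('k) ^ i))"
proof (rule poly_eqI)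
  fix k
  let ?p = "CHAR('k)"
  have inj: "?p ^ i = ?p ^ j \<longleftrightarrow> i = j" for i j
    using prime_gt_1_nat[OF p] by (simp add: power_inject_exp)
  show "coeff P k = coeff (\<Sum>i<N. monom (coeff P (?p ^ i)) (?p ^ i)) k"
  proof (cases "coeff P k = 0")
    case True
    then show ?thesis by (auto simp: coeff_sum intro!: sum.neutral)
  next
    case False
    then obtain i where i: "k = ?p ^ i" using P by (auto simp: linearized_def)
    have "k \<le> degree P" using False by (simp add: le_degree)
    then have "i < N" using deg i prime_gt_1_nat[OF p]
      by (meson le_less_trans power_less_imp_less_exp)
    then show ?thesis by (simp add: coeff_sum i inj)
  qed
qed

definition additive_map :: "('a::ab_group_add \<Rightarrow> 'b::ab_group_add) \<Rightarrow> bool" where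
  "additive_map f \<longleftrightarrow> (\<forall>x y. f (x + y) = f x + f y)"

lemma additive_map_add: "additive_map f \<Longrightarrow> f (x + y) = f x + f y"
  by (simp add: additive_map_def)

lemma additive_map_0: "additive_map f \<Longrightarrow> f 0 = 0"
  by (metis additive_map_def add_cancel_right_right)

lemma additive_map_minus: "additive_map f \<Longrightarrow> f (- x) = - f x"
  by (metis additive_map_0 additive_map_add add.right_inverse add_eq_0_iff)

lemma additive_map_diff: "additive_map f \<Longrightarrow> f (x - y) = f x - f y"
  using additive_map_add[of f x "- y"] by (simp add: additive_map_minus)

lemma additive_map_sum: "additive_map f \<Longrightarrow> f (sum g I) = (\<Sum>i\<in>I. f (g i))"
  by (induction I rule: infinite_finite_induct) (auto simp: additive_map_0 additive_map_add)

lemma additive_map_of_nat: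
  fixes f :: "'a::comm_ring_1 \<Rightarrow> 'k::comm_ring_1"
  assumes "additive_map f"
  shows "f (of_nat k * x) = of_nat k * f x"
  by (induction k) (auto simp: assms additive_map_0 additive_map_add distrib_right)

text \<open>
  The step from \<open>H\<close> to \<open>H + \<langle>g\<rangle>\<close>: if \<open>P\<close> is the product over \<open>H\<close>, then the product over the
  coset of \<open>k g\<close> is \<open>P\<close> shifted by a constant, that is \<open>P - k P(\<phi> g)\<close> because \<open>P\<close> is additive.
  The product of these over all \<open>k < p\<close> is \<open>P ^ p - P(\<phi> g) ^ (p - 1) P\<close>, again linearized.
  The map \<open>\<phi>\<close> is allowed to take values in another ring so that the lemma applies to the Redei
  polynomial, where that ring is a polynomial ring.
\<close>

lemma linearized_prod:
  fixes \<phi> :: "'a::{field,finite} \<Rightarrow> 'k::idom"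
  assumes char: "CHAR('k) = CHAR('a)" and \<phi>: "additive_map \<phi>"
    and G: "subspace_over prime_subfield (*) G"
  shows "linearized (\<Prod>x\<in>G. [:- \<phi> x, 1:])"
proof (rule subspace_over_induct[OF vector_space_field subfield_prime_subfield G, of "\<lambda>G. linearized (\<Prod>x\<in>G. [:- \<phi> x, 1:])"])
  show "linearized (\<Prod>x\<in>{0}. [:- \<phi> x, 1:])" by (simp add: additive_map_0[OF \<phi>] linearized_X)
next
  fix H :: "'a set" and g
  assume H: "subspace_over prime_subfield (*) H" "g \<notin> H"
    and IH: "linearized (\<Prod>x\<in>H. [:- \<phi> x, 1:])"
  let ?p = "CHAR('k)"
  have p: "prime ?p" unfolding char by (rule prime_CHAR_finite)
  have p': "prime (CHAR('k poly))" using p by simp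
  define P where "P = (\<Prod>x\<in>H. [:- \<phi> x, 1:])"
  define w where "w = \<phi> g"
  have shift: "(\<Prod>x\<in>H. [:- \<phi> (x + of_nat k * g), 1:]) = P - of_nat k * [:poly P w:]" for k
  proof -
    have add: "additive_map (poly P)"
      unfolding additive_map_def using linearized_poly_add[OF p] IH by (simp add: P_def)
    have "(\<Prod>x\<in>H. [:- \<phi> (x + of_nat k * g), 1:]) = (\<Prod>x\<in>H. pcompose [:- \<phi> x, 1:] [:- (of_nat k * w), 1:])"
      by (intro prod.cong) (simp_all add: pcompose_pCons additive_map_add[OF \<phi>]
        additive_map_of_nat[OF \<phi>] w_def)
    also have "\<dots> = pcompose P ([:0, 1:] + [:- (of_nat k * w):])"
      by (simp add: P_def pcompose_prod)
    also have "\<dots> = pcompose P [:0, 1:] + pcompose P [:- (of_nat k * w):]"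
      by (rule linearized_pcompose_add[OF p]) (use IH P_def in simp)
    also have "pcompose P [:- (of_nat k * w):] = [:poly P (- (of_nat k * w)):]"
      by (rule pcompose_const_right)
    also have "poly P (- (of_nat k * w)) = - (of_nat k * poly P w)"
      by (simp only: additive_map_minus[OF add] additive_map_of_nat[OF add])
    finally show ?thesis by (simp add: of_nat_poly)
  qed
  have "(\<Prod>x\<in>adjoin prime_subfield (*) H g. [:- \<phi> x, 1:])
      = (\<Prod>(x, l)\<in>H \<times> prime_subfield. [:- \<phi> (x + l * g), 1:])"
    unfolding adjoin_def
    using inj_on_adjoin[OF vector_space_field subfield_prime_subfield H]
    by (subst prod.reindex) (auto simp: case_prod_unfold)
  also have "\<dots> = (\<Prod>l\<in>prime_subfield. \<Prod>x\<in>H. [:- \<phi> (x + l * g), 1:])"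
    by (subst prod.cartesian_product[symmetric]) (rule prod.swap)
  also have "\<dots> = (\<Prod>k<?p. \<Prod>x\<in>H. [:- \<phi> (x + of_nat k * g), 1:])"
    unfolding prime_subfield_eq char
    using inj_on_of_nat_CHAR[where ?'a = 'a] by (subst prod.reindex) auto
  also have "\<dots> = (\<Prod>k<?p. P - of_nat k * [:poly P w:])" by (simp only: shift)
  also have "\<dots> = P ^ ?p - [:poly P w:] ^ (?p - 1) * P"
    using prod_diff_of_nat_mult[OF p', of P "[:poly P w:]"] by simp
  also have "\<dots> = P ^ ?p + smult (- (poly P w ^ (?p - 1))) P"
    by (simp add: poly_const_pow)
  finally have "(\<Prod>x\<in>adjoin prime_subfield (*) H g. [:- \<phi> x, 1:])
      = P ^ ?p + smult (- (poly P w ^ (?p - 1))) P" .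
  moreover have "linearized (P ^ ?p + smult (- (poly P w ^ (?p - 1))) P)"
    using IH by (intro linearized_add linearized_power_CHAR linearized_smult p) (simp_all add: P_def)
  ultimately show "linearized (\<Prod>x\<in>adjoin prime_subfield (*) H g. [:- \<phi> x, 1:])"
    by simp
qed auto

text \<open>
  Interpolation along a chain of subgroups: the product of \<open>X - x\<close> over \<open>H\<close> vanishes on \<open>H\<close> but
  not at \<open>g\<close>, so a multiple of it corrects the value at \<open>g\<close> without spoiling those on \<open>H\<close>.
\<close>

lemma additive_map_linearized:
  fixes f :: "'a::{field,finite} \<Rightarrow> 'a"
  assumes f: "additive_map f" and G: "subspace_over prime_subfield (*) G"
  shows "\<exists>P. linearized P \<and> degree P < card G \<and> (\<forall>x\<in>G. poly P x = f x)"
proof (rule subspace_over_induct[OF vector_space_field subfield_prime_subfield G,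
      of "\<lambda>G. \<exists>P. linearized P \<and> degree P < card G \<and> (\<forall>x\<in>G. poly P x = f x)"])
  show "\<exists>P. linearized P \<and> degree P < card {0::'a} \<and> (\<forall>x\<in>{0}. poly P x = f x)"
    by (intro exI[of _ 0]) (simp add: linearized_0 additive_map_0[OF f])
next
  fix H :: "'a set" and g
  assume H: "subspace_over prime_subfield (*) H" "g \<notin> H"
    and "\<exists>P. linearized P \<and> degree P < card H \<and> (\<forall>x\<in>H. poly P x = f x)"
  then obtain P where P: "linearized P" "degree P < card H" "\<And>x. x \<in> H \<Longrightarrow> poly P x = f x"
    by auto
  note p = prime_CHAR_finite[where ?'a = 'a]
  define R where "R = (\<Prod>x\<in>H. [:- x, 1:])"
  have R: "linearized R"
    unfolding R_def using linearized_prod[of "\<lambda>x. x", OF refl _ H(1)] by (simp add: additive_map_def)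
  have R0: "poly R x = 0" if "x \<in> H" for x
    unfolding R_def poly_prod using that by (auto intro!: prod_zero)
  have Rg: "poly R g \<noteq> 0"
    unfolding R_def poly_prod using H(2) by (auto simp: prod_zero_iff)
  have dR: "degree R = card H" unfolding R_def by (subst degree_prod_eq_sum_degree) auto
  define P' where "P' = P + smult ((f g - poly P g) / poly R g) R"
  have P': "linearized P'" unfolding P'_def by (intro linearized_add linearized_smult P R)
  have add: "additive_map (poly P')"
    unfolding additive_map_def using linearized_poly_add[OF p P'] by blast
  have "poly P' x = f x" if x: "x \<in> adjoin prime_subfield (*) H g" for x
  proof -
    obtain h k where h: "h \<in> H" "x = h + of_nat k * g"
      using x by (auto simp: adjoin_def prime_subfield_def)
    have "poly P' h = f h" using h by (simp add: P'_def P R0)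
    moreover have "poly P' g = f g" using Rg by (simp add: P'_def)
    ultimately show ?thesis
      by (simp add: h additive_map_add[OF f] additive_map_add[OF add]
        additive_map_of_nat[OF f] additive_map_of_nat[OF add])
  qed
  moreover have "degree P' < card (adjoin prime_subfield (*) H g)"
  proof -
    have "degree P' \<le> card H" unfolding P'_def
      by (rule degree_add_le) (use P dR in \<open>auto intro: order.trans[OF degree_smult_le]\<close>)
    also have "card H < card H * CHAR('a)"
      using P(2) prime_gt_1_nat[OF p] by simp
    finally show ?thesis
      by (simp add: card_adjoin[OF vector_space_field subfield_prime_subfield H] card_prime_subfield)
  qed
  ultimately show "\<exists>P. linearized P \<and> degree P < card (adjoin prime_subfield (*) H g) \<and>
      (\<forall>x\<in>adjoin prime_subfield (*) H g. poly P x = f x)" using P' by blast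
qed auto

section \<open>Recursions without cancellation\<close>

lemma sum_power_less:
  fixes p :: nat
  assumes "p \<ge> 2" "A \<subseteq> {..<m}"
  shows "(\<Sum>x\<in>A. p ^ x) < p ^ m"
proof -
  have "(\<Sum>x<m. p ^ x) < p ^ m"
  proof (induction m)
    case (Suc m)
    have "(\<Sum>x<Suc m. p ^ x) < 2 * p ^ m" using Suc by simp
    also have "\<dots> \<le> p ^ Suc m" using assms(1) by simp
    finally show ?case .
  qed simp
  moreover have "(\<Sum>x\<in>A. p ^ x) \<le> (\<Sum>x<m. p ^ x)"
    using assms(2) by (intro sum_mono2) auto
  ultimately show ?thesis by linarith
qed

text \<open>
  Base \<open>p\<close> expansions with digits \<open>0\<close> and \<open>1\<close> are unique: the largest element of the symmetric
  difference decides which sum is larger.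
\<close>

lemma sum_power_eq_imp_eq:
  fixes p :: nat
  assumes p: "p \<ge> 2" and fin: "finite S" "finite T"
    and eq: "(\<Sum>x\<in>S. p ^ x) = (\<Sum>x\<in>T. p ^ x)"
  shows "S = T"
proof (rule ccontr)
  have less: "(\<Sum>x\<in>S. p ^ x) < (\<Sum>x\<in>T. p ^ x)"
    if "finite S" "finite T" "m \<notin> S" "m \<in> T" and same: "\<And>x. x > m \<Longrightarrow> x \<in> S \<longleftrightarrow> x \<in> T" for S T m
  proof -
    have "(\<Sum>x\<in>S. p ^ x) = (\<Sum>x\<in>{x\<in>S. x > m}. p ^ x) + (\<Sum>x\<in>{x\<in>S. x < m}. p ^ x)"
      using that(1,3) by (subst sum.union_disjoint[symmetric])
        (auto intro!: sum.cong, metis linorder_neqE_nat)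
    also have "{x\<in>S. x > m} = {x\<in>T. x > m}" using same by auto
    also have "(\<Sum>x\<in>{x\<in>S. x < m}. p ^ x) < p ^ m" by (rule sum_power_less[OF p]) auto
    also have "(\<Sum>x\<in>{x\<in>T. x > m}. p ^ x) + p ^ m = (\<Sum>x\<in>insert m {x\<in>T. x > m}. p ^ x)"
      using that(2) by simp
    also have "\<dots> \<le> (\<Sum>x\<in>T. p ^ x)" using that by (intro sum_mono2) auto
    finally show ?thesis by simp
  qed
  assume "S \<noteq> T"
  define D where "D = (S - T) \<union> (T - S)"
  have "finite D" "D \<noteq> {}" using \<open>S \<noteq> T\<close> fin by (auto simp: D_def)
  then have M: "Max D \<in> D" by simp
  have above: "x \<in> S \<longleftrightarrow> x \<in> T" if "x > Max D" for x
  proof -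
    have "x \<notin> D" using Max_ge[OF \<open>finite D\<close>, of x] that by linarith
    then show ?thesis by (auto simp: D_def)
  qed
  have "Max D \<notin> S \<and> Max D \<in> T \<or> Max D \<notin> T \<and> Max D \<in> S" using M by (auto simp: D_def)
  then show False
    using less[OF fin, of "Max D"] less[OF fin(2,1), of "Max D"] above eq by auto
qed

lemma poly_sum_distinct_degrees:
  fixes B :: "nat \<Rightarrow> 'k::idom poly"
  assumes fin: "finite I"
    and i: "i \<in> I" "\<gamma> i \<noteq> 0" "B i \<noteq> 0"
    and max: "\<And>k. k \<in> I \<Longrightarrow> k \<noteq> i \<Longrightarrow> \<gamma> k \<noteq> 0 \<Longrightarrow> B k \<noteq> 0 \<Longrightarrow> degree (B k) < degree (B i)"
  shows "degree (\<Sum>k\<in>I. smult (\<gamma> k) (B k)) = degree (B i)" "(\<Sum>k\<in>I. smult (\<gamma> k) (B k)) \<noteq> 0"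
proof -
  let ?T = "\<Sum>k\<in>I. smult (\<gamma> k) (B k)"
  have "coeff (smult (\<gamma> k) (B k)) (degree (B i)) = 0" if "k \<in> I - {i}" for k
    using max[of k] that by (cases "\<gamma> k = 0 \<or> B k = 0") (auto intro: coeff_eq_0)
  then have rest: "(\<Sum>k\<in>I - {i}. coeff (smult (\<gamma> k) (B k)) (degree (B i))) = 0"
    by (rule sum.neutral[OF ballI])
  have "coeff ?T (degree (B i)) = (\<Sum>k\<in>I. coeff (smult (\<gamma> k) (B k)) (degree (B i)))"
    by (simp only: coeff_sum)
  also have "\<dots> = \<gamma> i * lead_coeff (B i)"
    using sum.remove[OF fin i(1)] rest by (metis add.right_neutral coeff_smult)
  finally have nz: "coeff ?T (degree (B i)) \<noteq> 0" using i by simp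
  then show "?T \<noteq> 0" by auto
  have "degree ?T \<le> degree (B i)"
  proof (rule degree_sum_le[OF fin])
    show "degree (smult (\<gamma> k) (B k)) \<le> degree (B i)" if "k \<in> I" for k
      using max[of k] that by (cases "k = i \<or> \<gamma> k = 0 \<or> B k = 0") auto
  qed
  then show "degree ?T = degree (B i)" using le_degree[OF nz] by simp
qed

text \<open>
  If no cancellation of top terms occurs, then the degree of \<open>B j\<close> is smaller by \<open>p ^ j\<close> than the
  degree of some earlier \<open>B i\<close> in the recursion. Going back to \<open>B 0\<close>, the difference of the degrees
  of \<open>B 0\<close> and \<open>B j\<close> is the sum of \<open>p ^ x\<close> over the set \<open>S\<close> of indices passed on the way. The
  uniqueness of such expansions recovers \<open>S\<close> from the degree, and \<open>j\<close> is the element of \<open>S\<close> of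
  smallest degree. So degrees are distinct, and this is what excludes cancellation; both facts are
  proved in one induction, by decreasing degree.
\<close>

lemma distinct_degrees:
  fixes B :: "nat \<Rightarrow> 'k::idom poly"
  assumes p: "p \<ge> (2::nat)"
    and rel: "\<And>j. 0 < j \<Longrightarrow> j < N \<Longrightarrow> B j * monom 1 (p ^ j) = (\<Sum>i<N. smult (\<gamma> j i) (B i))"
    and deg: "\<And>j. 0 < j \<Longrightarrow> j < N \<Longrightarrow> B j \<noteq> 0 \<Longrightarrow> degree (B j) < degree (B 0)"
    and ij: "i < N" "j < N" "B i \<noteq> 0" "B j \<noteq> 0" "degree (B i) = degree (B j)"
  shows "i = j"
proof -
  let ?D = "degree (B 0)"
  define Q where "Q j S \<longleftrightarrow> finite S \<and> ?D = degree (B j) + (\<Sum>x\<in>S. p ^ x) \<and>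
     (if j = 0 then S = {} else j \<in> S) \<and> (\<forall>x\<in>S. x = j \<or> degree (B j) < degree (B x))" for j S
  have uniq: "i = j" if "Q i S" "Q j T" "degree (B i) = degree (B j)" for i j S T
  proof -
    have "S = T" using that by (intro sum_power_eq_imp_eq[OF p]) (auto simp: Q_def)
    with that show ?thesis unfolding Q_def by (metis empty_iff nat_less_le)
  qed
  have ex: "\<exists>S. Q j S" if "j < N" "B j \<noteq> 0" for j
    using that
  proof (induction "?D - degree (B j)" arbitrary: j rule: less_induct)
    case less
    show ?case
    proof (cases "j = 0")
      case True
      then show ?thesis by (intro exI[of _ "{}"]) (simp add: Q_def)
    next
      case False
      have le: "degree (B k) \<le> ?D" if "k < N" "B k \<noteq> 0" for k
        using deg[of k] that by (cases "k = 0") auto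
      have IH: "\<exists>S. Q k S" if "k < N" "B k \<noteq> 0" "degree (B j) < degree (B k)" for k
        using less(1)[of k] le[of k] that by simp
      (* The degree of T exceeds that of B j, so T is governed by the terms of larger degree;
         those have distinct degrees by the induction hypothesis. *)
      define T where "T = (\<Sum>i<N. smult (\<gamma> j i) (B i))"
      have "T = B j * monom 1 (p ^ j)" unfolding T_def using rel[of j] False less.prems by simp
      then have dT: "degree T = degree (B j) + p ^ j"
        using less.prems by (simp add: degree_mult_eq degree_monom_eq)
      define K where "K = {i. i < N \<and> \<gamma> j i \<noteq> 0 \<and> B i \<noteq> 0 \<and> degree (B j) < degree (B i)}"
      have finK: "finite K" by (simp add: K_def)
      have "K \<noteq> {}"
      proof
        assume "K = {}"
        have "degree (smult (\<gamma> j i) (B i)) \<le> degree (B j)" if "i < N" for i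
        proof -
          have "i \<notin> K" using \<open>K = {}\<close> by simp
          then show ?thesis using that by (auto simp: K_def not_less)
        qed
        then have "degree T \<le> degree (B j)" unfolding T_def by (intro degree_sum_le) auto
        with dT p show False by simp
      qed
      then obtain i where i: "i \<in> K" "\<And>k. k \<in> K \<Longrightarrow> degree (B k) \<le> degree (B i)"
        using obtains_MAX[OF finK, of "\<lambda>i. degree (B i)"] finK by (metis Max_ge finite_imageI imageI)
      have "degree (B k) < degree (B i)" if "k < N" "k \<noteq> i" "\<gamma> j k \<noteq> 0" "B k \<noteq> 0" for k
      proof (cases "k \<in> K")
        case True
        then have "\<exists>S. Q k S" "\<exists>S. Q i S" using IH i(1) by (auto simp: K_def)
        then have "degree (B k) \<noteq> degree (B i)" using uniq that(2) by blast
        then show ?thesis using i(2)[OF True] by simp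
      next
        case False
        then show ?thesis using that i(1) by (auto simp: K_def)
      qed
      then have "degree T = degree (B i)" unfolding T_def
        using i(1) by (intro poly_sum_distinct_degrees) (auto simp: K_def)
      then have di: "degree (B i) = degree (B j) + p ^ j" using dT by simp
      obtain S where S: "Q i S" using IH i(1) by (auto simp: K_def)
      have lt: "degree (B j) < degree (B i)" using i(1) by (simp add: K_def)
      have "j \<notin> S" using S lt by (auto simp: Q_def)
      then have "Q j (insert j S)" using S lt False di by (auto simp: Q_def)
      then show ?thesis by blast
    qed
  qed
  show ?thesis using uniq ex ij by blast
qed

text \<open>
  Modulo \<open>N\<close> subtracting \<open>b\<close> is adding \<open>(N - 1) b\<close>, so the shifts that preserve \<open>ok\<close> are closed
  under the Bezout combinations that produce a greatest common divisor.
\<close>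

lemma Gcd_shift_closed:
  fixes ok :: "nat \<Rightarrow> bool"
  assumes "N > 0" and per: "\<And>t. ok t \<longleftrightarrow> ok (t mod N)" and ok0: "ok 0"
    and "finite S" and S: "\<And>s t. s \<in> S \<Longrightarrow> ok t \<Longrightarrow> ok (t + s)"
  shows "ok (Gcd (insert N S))"
proof -
  have N: "ok (t + N * k) \<longleftrightarrow> ok t" for t k
    using per[of "t + N * k"] per[of t] by simp
  define C where "C = {a. \<forall>t. ok t \<longrightarrow> ok (t + a)}"
  have mult: "ok (t + k * a)" if "a \<in> C" "ok t" for a t k
  proof (induction k)
    case (Suc k)
    then have "ok (t + k * a + a)" using that(1) unfolding C_def by blast
    then show ?case by (simp add: algebra_simps)
  qed (use that in simp)
  have gcd: "gcd a b \<in> C" if "a \<in> C" "b \<in> C" for a b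
  proof (cases "a = 0")
    case False
    obtain x y where xy: "a * x = b * y + gcd a b" using bezout_nat[OF False] by blast
    have "ok (t + gcd a b)" if "ok t" for t
    proof -
      have "ok (t + x * a + ((N - 1) * y) * b)"
        using mult \<open>a \<in> C\<close> \<open>b \<in> C\<close> that by blast
      moreover have "t + x * a + ((N - 1) * y) * b = (t + gcd a b) + N * (y * b)"
        using xy \<open>N > 0\<close> by (cases N) (auto simp: algebra_simps)
      ultimately show ?thesis using N by metis
    qed
    then show ?thesis by (simp add: C_def)
  qed (use that in simp)
  have "Gcd (insert N S) \<in> C"
    using \<open>finite S\<close> S
  proof (induction S)
    case empty
    then show ?case using N[of _ 1] by (simp add: C_def)
  next
    case (insert s S)
    then have "gcd s (Gcd (insert N S)) \<in> C" by (intro gcd) (auto simp: C_def)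
    then show ?case by (simp add: insert_commute gcd.left_commute)
  qed
  then show ?thesis using ok0 by (auto simp: C_def)
qed

section \<open>Products over the image of an additive map\<close>

lemma finite_field_power_CARD:
  fixes x :: "'a::{field,finite}"
  shows "x ^ CARD('a) = x"
proof (cases "x = 0")
  case False
  have "(\<Prod>y\<in>UNIV - {0}. x * y) = \<Prod>(UNIV - {0::'a})"
    by (rule prod.reindex_bij_witness[of _ "\<lambda>y. y / x" "\<lambda>y. x * y"]) (use False in auto)
  then have "x ^ (CARD('a) - 1) * \<Prod>(UNIV - {0::'a}) = \<Prod>(UNIV - {0::'a})"
    by (simp add: prod.distrib)
  moreover have "\<Prod>(UNIV - {0::'a}) \<noteq> 0" by (simp add: prod_zero_iff)
  ultimately have "x ^ (CARD('a) - 1) = 1" by simp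
  then show ?thesis by (metis finite_UNIV_card_ge_0 finite mult_1 power_minus_mult)
qed (simp add: power_0_left)

lemma poly_eq_0_finite_field:
  fixes P :: "'a::{field,finite} poly"
  assumes "degree P < CARD('a)" "\<And>x. poly P x = 0"
  shows "P = 0"
proof (rule ccontr)
  assume "P \<noteq> 0"
  then have "card {x. poly P x = 0} \<le> degree P" by (rule card_poly_roots_bound)
  then show False using assms by simp
qed

lemma prod_X_minus_UNIV:
  "(\<Prod>z\<in>UNIV. [:- z, 1:]) = monom 1 (CARD('a)) - monom (1::'a::{field,finite}) 1"
proof -
  let ?T = "\<Prod>z\<in>(UNIV::'a set). [:- z, 1:]"
  let ?S = "monom 1 (CARD('a)) - monom (1::'a) 1"
  have card: "CARD('a) > 1" by (rule one_less_CARD_field)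
  have dT: "degree ?T = CARD('a)" by (subst degree_prod_eq_sum_degree) auto
  have lT: "coeff ?T (CARD('a)) = 1" using lead_coeff_prod[of "\<lambda>z::'a. [:- z, 1:]" UNIV] dT by simp
  show ?thesis
  proof (rule poly_eqI_degree_lead_coeff[where A = UNIV and n = "CARD('a)"])
    show "poly ?T z = poly ?S z" for z
      by (subst poly_prod, subst prod_zero)
        (auto simp: poly_monom finite_field_power_CARD intro!: bexI[of _ z])
    show "degree ?S \<le> CARD('a)"
      using card by (intro degree_diff_le) (auto intro: order.trans[OF degree_monom_le])
  qed (use dT lT card in auto)
qed

lemma coeff_linear_times:
  fixes c :: "'k::comm_ring_1"
  shows
  "coeff ([:- c, 1:] * P) k = (if k = 0 then 0 else coeff P (k - 1)) - c * coeff P k"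
  by (cases k) (simp_all add: coeff_pCons algebra_simps)

text \<open>
  Each factor has total degree at most one in \<open>X\<close> and the variable of the coefficients together, so
  the product has total degree at most \<open>card S\<close>.
\<close>

lemma degree_coeff_prod_le:
  fixes \<phi> :: "'b \<Rightarrow> 'k::idom poly"
  assumes "finite S" "\<And>x. x \<in> S \<Longrightarrow> degree (\<phi> x) \<le> 1"
  shows "degree (coeff (\<Prod>x\<in>S. [:- \<phi> x, 1:]) k) \<le> card S - k"
  using assms
proof (induction S arbitrary: k)
  case empty
  then show ?case by (cases k) auto
next
  case (insert x S)
  let ?P = "\<Prod>x\<in>S. [:- \<phi> x, 1:]"
  have dP: "degree ?P = card S" by (subst degree_prod_eq_sum_degree) auto
  have "degree (\<phi> x * coeff ?P k) \<le> Suc (card S) - k"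
  proof (cases "k \<le> card S")
    case True
    have "degree (\<phi> x * coeff ?P k) \<le> degree (\<phi> x) + degree (coeff ?P k)" by (rule degree_mult_le)
    also have "\<dots> \<le> 1 + (card S - k)" using insert by (intro add_mono) auto
    finally show ?thesis using True by simp
  next
    case False
    then have "coeff ?P k = 0" using dP by (intro coeff_eq_0) simp
    then show ?thesis by simp
  qed
  moreover have "degree (if k = 0 then 0 else coeff ?P (k - 1)) \<le> Suc (card S) - k"
  proof (cases k)
    case (Suc m)
    then show ?thesis using insert.IH[of m] insert.prems by simp
  qed simp
  ultimately show ?case
    unfolding prod.insert[OF insert.hyps] card.insert[OF insert.hyps] coeff_linear_times
    by (intro degree_diff_le)
qed

lemma poly_coeff_prod:
  fixes \<phi> :: "'b \<Rightarrow> 'k::idom poly"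
  shows "poly (coeff (\<Prod>x\<in>S. [:- \<phi> x, 1:]) k) y = coeff (\<Prod>x\<in>S. [:- poly (\<phi> x) y, 1:]) k"
proof (induction S arbitrary: k rule: infinite_finite_induct)
  case (insert x S)
  show ?case
    unfolding prod.insert[OF insert.hyps] coeff_linear_times by (simp add: insert.IH)
qed (auto simp: coeff_pCons split: nat.splits)

lemma subspace_over_prime_subfield_scale:
  fixes scale :: "'a::{field,finite} \<Rightarrow> 'v::ab_group_add \<Rightarrow> 'v"
  assumes vs: "vector_space scale" and "0 \<in> S" "\<And>x y. x \<in> S \<Longrightarrow> y \<in> S \<Longrightarrow> x + y \<in> S"
  shows "subspace_over prime_subfield scale S"
proof -
  interpret vector_space scale by fact
  have "scale (of_nat k) x \<in> S" if "x \<in> S" for x k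
    by (induction k) (auto simp: assms(2,3) that scale_left_distrib)
  then show ?thesis using assms(2,3) by (auto simp: subspace_over_def prime_subfield_def)
qed

lemma subspace_over_prime_subfield:
  fixes S :: "'a::{field,finite} set"
  assumes "0 \<in> S" "\<And>x y. x \<in> S \<Longrightarrow> y \<in> S \<Longrightarrow> x + y \<in> S"
  shows "subspace_over prime_subfield (*) S"
  using subspace_over_prime_subfield_scale[OF vector_space_field assms] .

lemma card_power_CHAR:
  fixes S :: "'a::{field,finite} set"
  assumes "0 \<in> S" "\<And>x y. x \<in> S \<Longrightarrow> y \<in> S \<Longrightarrow> x + y \<in> S"
  shows "\<exists>e. card S = CHAR('a) ^ e"
  using card_subspace_over_power[OF vector_space_field subfield_prime_subfield
      subspace_over_prime_subfield[OF assms]] by (simp add: card_prime_subfield)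

lemma CARD_eq_CHAR_power: "\<exists>N. CARD('a::{field,finite}) = CHAR('a) ^ N"
  using card_power_CHAR[of "UNIV :: 'a set"] by simp

lemma card_fibre:
  fixes g :: "'v::ab_group_add \<Rightarrow> 'b::ab_group_add"
  assumes g: "additive_map g" and S: "\<And>x y. x \<in> S \<Longrightarrow> y \<in> S \<Longrightarrow> x + y \<in> S"
    "\<And>x y. x \<in> S \<Longrightarrow> y \<in> S \<Longrightarrow> x - y \<in> S" and a: "a \<in> S"
  shows "card {x\<in>S. g x = g a} = card {x\<in>S. g x = 0}"
proof -
  have "{x\<in>S. g x = g a} = (\<lambda>x. x + a) ` {x\<in>S. g x = 0}"
  proof (intro equalityI subsetI)
    fix x assume "x \<in> {x\<in>S. g x = g a}"
    then show "x \<in> (\<lambda>x. x + a) ` {x\<in>S. g x = 0}"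
      using a S by (intro image_eqI[of _ _ "x - a"]) (auto simp: additive_map_diff[OF g])
  qed (use a S in \<open>auto simp: additive_map_add[OF g]\<close>)
  then show ?thesis by (simp add: card_image)
qed

lemma card_image_ker:
  fixes g :: "'v::ab_group_add \<Rightarrow> 'b::ab_group_add"
  assumes g: "additive_map g" and S: "finite S" "\<And>x y. x \<in> S \<Longrightarrow> y \<in> S \<Longrightarrow> x + y \<in> S"
    "\<And>x y. x \<in> S \<Longrightarrow> y \<in> S \<Longrightarrow> x - y \<in> S"
  shows "card (g ` S) * card {x\<in>S. g x = 0} = card S"
proof -
  have "card S = (\<Sum>y\<in>g ` S. card {x\<in>S. g x = y})"
    using sum.image_gen[OF S(1), of "\<lambda>_. 1::nat" g] by simp
  also have "\<dots> = (\<Sum>y\<in>g ` S. card {x\<in>S. g x = 0})"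
    by (intro sum.cong) (auto simp: card_fibre[OF g S(2,3)])
  finally show ?thesis by simp
qed

lemma card_range_ker:
  fixes g :: "'a::{ab_group_add,finite} \<Rightarrow> 'b::ab_group_add"
  assumes g: "additive_map g"
  shows "card (range g) * card {x. g x = 0} = CARD('a)"
  using card_image_ker[OF g, of UNIV] by simp

text \<open>
  All fibres of \<open>g\<close> have the size of the kernel.
\<close>

lemma prod_additive_map:
  fixes g :: "'a::{ab_group_add,finite} \<Rightarrow> 'b::idom"
  assumes g: "additive_map g"
  shows "(\<Prod>x\<in>UNIV. [:- g x, 1:]) = (\<Prod>z\<in>range g. [:- z, 1:]) ^ card {x. g x = 0}"
proof -
  have "(\<Prod>x\<in>UNIV. [:- g x, 1:]) = (\<Prod>y\<in>range g. \<Prod>x\<in>{x\<in>UNIV. g x = y}. [:- g x, 1:])"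
    by (rule prod.image_gen) simp
  also have "\<dots> = (\<Prod>y\<in>range g. [:- y, 1:] ^ card {x. g x = 0})"
    using card_fibre[OF g, of UNIV] by (intro prod.cong) auto
  finally show ?thesis by (simp add: prod_power_distrib)
qed

text \<open>
  If \<open>g\<close> is bijective, the product is \<open>X ^ Q - X\<close>. Otherwise it is a power whose exponent is the
  order of the kernel, a power of \<open>p\<close>; by Frobenius only multiples of this order occur as
  exponents of \<open>X\<close>.
\<close>

lemma coeff_prod_additive_map_eq_0:
  fixes g :: "'a::{field,finite} \<Rightarrow> 'a"
  assumes g: "additive_map g"
    and i: "0 < i" "CHAR('a) ^ i < CARD('a)"
    and ker: "{x. g x = 0} \<noteq> {0} \<Longrightarrow> CHAR('a) ^ i < card {x. g x = 0}"
  shows "coeff (\<Prod>x\<in>UNIV. [:- g x, 1:]) (CHAR('a) ^ i) = 0"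
proof (cases "{x. g x = 0} = {0}")
  case True
  have "inj g"
  proof (rule injI)
    fix x y assume "g x = g y"
    then have "x - y \<in> {x. g x = 0}" by (simp add: additive_map_diff[OF g])
    then have "x - y = 0" unfolding True by (rule singletonD)
    then show "x = y" by simp
  qed
  then have "range g = UNIV" by (simp add: finite_UNIV_inj_surj)
  then have "(\<Prod>x\<in>UNIV. [:- g x, 1:]) = monom 1 (CARD('a)) - monom 1 1"
    using prod_additive_map[OF g] prod_X_minus_UNIV unfolding True by simp
  moreover have "1 < CHAR('a) ^ i"
    using i(1) by (intro one_less_power prime_gt_1_nat prime_CHAR_finite)
  ultimately show ?thesis using i(2) by (simp add: coeff_diff)
next
  case False
  let ?T = "\<Prod>z\<in>range g. [:- z, 1:]"
  let ?p = "CHAR('a)"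
  obtain w where w: "card {x. g x = 0} = ?p ^ w"
    using card_power_CHAR[of "{x. g x = 0}"]
    by (auto simp: additive_map_0[OF g] additive_map_add[OF g])
  have less: "?p ^ i < ?p ^ w" using ker[OF False] w by simp
  have "coeff (?T ^ ?p ^ w) (?p ^ i) = 0"
  proof -
    have "coeff (monom (coeff ?T k ^ ?p ^ w) (k * ?p ^ w)) (?p ^ i) = 0" for k
    proof -
      have "k * ?p ^ w \<noteq> ?p ^ i"
      proof (cases k)
        case 0
        then show ?thesis using prime_gt_0_nat[OF prime_CHAR_finite[where ?'a = 'a]] by simp
      next
        case (Suc m)
        then have "?p ^ w \<le> k * ?p ^ w" by simp
        then show ?thesis using less by linarith
      qed
      then show ?thesis by simp
    qed
    then show ?thesis
      by (subst poly_frobenius[OF prime_CHAR_finite refl]) (simp only: coeff_sum sum.neutral_const)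
  qed
  then show ?thesis unfolding prod_additive_map[OF g] w .
qed

text \<open>
  The coefficients of a fixed power of the variable form a polynomial in \<open>x\<close> of degree less than
  \<open>Q\<close> that vanishes on the whole field.
\<close>

lemma linearized_independent:
  fixes G :: "nat \<Rightarrow> 'a::{field,finite} poly"
  assumes N: "CARD('a) = CHAR('a) ^ N"
    and zero: "\<And>x. (\<Sum>j<N. smult (x ^ CHAR('a) ^ j) (G j)) = 0" and j: "j < N"
  shows "G j = 0"
proof (rule poly_eqI)
  fix t
  let ?p = "CHAR('a)"
  note p = prime_gt_1_nat[OF prime_CHAR_finite[where ?'a = 'a]]
  define P where "P = (\<Sum>j<N. monom (coeff (G j) t) (?p ^ j))"
  have "P = 0"
  proof (rule poly_eq_0_finite_field)
    have "degree P \<le> CARD('a) - 1" unfolding P_def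
    proof (rule degree_sum_le)
      show "degree (monom (coeff (G j) t) (?p ^ j)) \<le> CARD('a) - 1" if "j \<in> {..<N}" for j
      proof -
        have "?p ^ j < ?p ^ N" using that p by simp
        then show ?thesis using degree_monom_le[of "coeff (G j) t" "?p ^ j"] N by linarith
      qed
    qed simp
    then show "degree P < CARD('a)" by (metis finite_UNIV_card_ge_0 finite diff_less le_less_trans zero_less_one)
    show "poly P x = 0" for x
    proof -
      have "poly P x = coeff (\<Sum>j<N. smult (x ^ ?p ^ j) (G j)) t"
        by (simp add: P_def poly_sum poly_monom coeff_sum mult.commute)
      then show ?thesis by (simp only: zero coeff_0)
    qed
  qed
  then have "coeff P (?p ^ j) = 0" by simp
  then show "coeff (G j) t = coeff 0 t"
    using j p by (simp add: P_def coeff_sum)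
qed

section \<open>The Redei polynomial of an additive map\<close>

lemma additive_map_as_sum:
  fixes f :: "'a::{field,finite} \<Rightarrow> 'a"
  assumes N: "CARD('a) = CHAR('a) ^ N" and f: "additive_map f"
  shows "\<exists>c. \<forall>x. f x = (\<Sum>t<N. c t * x ^ CHAR('a) ^ t)"
proof -
  have "subspace_over prime_subfield (*) (UNIV :: 'a set)" by (rule subspace_over_prime_subfield) auto
  from additive_map_linearized[OF f this] obtain P
    where P: "linearized P" "degree P < CARD('a)" "\<And>x. poly P x = f x" by auto
  let ?c = "\<lambda>t. coeff P (CHAR('a) ^ t)"
  have sum: "P = (\<Sum>t<N. monom (?c t) (CHAR('a) ^ t))"
    using linearized_as_sum[OF prime_CHAR_finite P(1)] P(2) N by simp
  have "f x = (\<Sum>t<N. ?c t * x ^ CHAR('a) ^ t)" for x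
  proof -
    have "poly P x = poly (\<Sum>t<N. monom (?c t) (CHAR('a) ^ t)) x" using sum by (rule arg_cong)
    then show ?thesis by (simp only: P poly_sum poly_monom)
  qed
  then show ?thesis by (intro exI[of _ ?c]) blast
qed

lemma add_mod_diff_cancel:
  fixes i s N :: nat
  assumes "i < N" "s < N"
  shows "((i + s) mod N + N - i) mod N = s"
proof (cases "i + s < N")
  case True
  then show ?thesis using assms by simp
next
  case False
  then have "(i + s) mod N = i + s - N" using assms by (simp add: mod_if)
  then show ?thesis using False assms by simp
qed

text \<open>
  Exponents of the Frobenius are read modulo \<open>N\<close>, since its \<open>N\<close>-th power is the identity.
\<close>

lemma power_of_power_sum:
  fixes c :: "nat \<Rightarrow> 'a::{field,finite}"
  assumes N: "CARD('a) = CHAR('a) ^ N" and i: "i < N"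
  shows "(\<Sum>t<N. c t * x ^ CHAR('a) ^ t) ^ CHAR('a) ^ i
       = (\<Sum>j<N. c ((j + N - i) mod N) ^ CHAR('a) ^ i * x ^ CHAR('a) ^ j)"
proof -
  let ?p = "CHAR('a)"
  have red: "x ^ ?p ^ (t + i) = x ^ ?p ^ ((t + i) mod N)" if "t < N" for t
  proof (cases "t + i < N")
    case False
    then have "x ^ ?p ^ (t + i) = (x ^ ?p ^ N) ^ ?p ^ (t + i - N)"
      by (simp flip: power_mult power_add)
    also have "x ^ ?p ^ N = x" using finite_field_power_CARD[of x] by (simp only: N)
    also have "t + i - N = (t + i) mod N" using that i False by (simp add: mod_if)
    finally show ?thesis .
  qed simp
  have "(\<Sum>t<N. c t * x ^ ?p ^ t) ^ ?p ^ i = (\<Sum>t<N. (c t * x ^ ?p ^ t) ^ ?p ^ i)"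
    by (rule freshmans_dream_sum'[OF prime_CHAR_finite refl])
  also have "\<dots> = (\<Sum>t<N. c t ^ ?p ^ i * x ^ ?p ^ ((t + i) mod N))"
  proof (rule sum.cong)
    fix t assume "t \<in> {..<N}"
    have "(c t * x ^ ?p ^ t) ^ ?p ^ i = c t ^ ?p ^ i * x ^ ?p ^ (t + i)"
      by (simp add: power_mult_distrib power_add flip: power_mult)
    then show "(c t * x ^ ?p ^ t) ^ ?p ^ i = c t ^ ?p ^ i * x ^ ?p ^ ((t + i) mod N)"
      using red \<open>t \<in> {..<N}\<close> by simp
  qed simp
  also have "\<dots> = (\<Sum>j<N. c ((j + N - i) mod N) ^ ?p ^ i * x ^ ?p ^ j)"
  proof (rule sum.reindex_bij_witness[of _ "\<lambda>j. (j + N - i) mod N" "\<lambda>t. (t + i) mod N"])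
    fix t assume t: "t \<in> {..<N}"
    show *: "((t + i) mod N + N - i) mod N = t"
      using add_mod_diff_cancel[of i N t] t i by (simp add: add.commute)
    show "c (((t + i) mod N + N - i) mod N) ^ ?p ^ i * x ^ ?p ^ ((t + i) mod N)
        = c t ^ ?p ^ i * x ^ ?p ^ ((t + i) mod N)" by (simp only: *)
    show "(t + i) mod N \<in> {..<N}" using i by simp
  next
    fix j assume j: "j \<in> {..<N}"
    have "((j + N - i) mod N + i) mod N = (j + N - i + i) mod N" by (simp only: mod_add_left_eq)
    also have "\<dots> = j" using i j by simp
    finally show "((j + N - i) mod N + i) mod N = j" .
    show "(j + N - i) mod N \<in> {..<N}" using i by simp
  qed
  finally show ?thesis .
qed

lemma linear_poly_power_CHAR:
  fixes a :: "'a::{field,finite}"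
  shows "[:a, - x:] ^ CHAR('a) ^ i = [:a ^ CHAR('a) ^ i:] - monom (x ^ CHAR('a) ^ i) (CHAR('a) ^ i)"
proof -
  have p: "prime (CHAR('a poly))" by (simp add: prime_CHAR_finite)
  have add: "additive_map (\<lambda>x::'a poly. x ^ CHAR('a) ^ i)"
    unfolding additive_map_def using freshmans_dream'[OF p, of "CHAR('a) ^ i" i] by simp
  have "[:a, - x:] = [:a:] - monom x 1" by (simp add: monom_altdef)
  then have "[:a, - x:] ^ CHAR('a) ^ i = [:a:] ^ CHAR('a) ^ i - monom x 1 ^ CHAR('a) ^ i"
    by (simp only: additive_map_diff[OF add])
  then show ?thesis by (simp add: monom_power poly_const_pow)
qed

lemma sum_lessThan_Suc_merge_ends:
  fixes F :: "nat \<Rightarrow> 'b::comm_monoid_add"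
  assumes "N > 0"
  shows "(\<Sum>i<Suc N. F i) = (\<Sum>i<N. if i = 0 then F 0 + F N else F i)"
proof -
  obtain M where N: "N = Suc M" using assms by (cases N) auto
  have "(\<Sum>i<N. F i) = F 0 + (\<Sum>i<M. F (Suc i))" unfolding N by (rule sum.lessThan_Suc_shift)
  moreover have "(\<Sum>i<N. if i = 0 then F 0 + F N else F i) = F 0 + F N + (\<Sum>i<M. F (Suc i))"
    unfolding N by (subst sum.lessThan_Suc_shift) simp
  ultimately show ?thesis by (simp add: add_ac)
qed

lemma smult_sum_right: "smult c (\<Sum>i\<in>I. P i) = (\<Sum>i\<in>I. smult c (P i))"
  by (induction I rule: infinite_finite_induct) (auto simp: smult_add_right)

text \<open>
  In the variables \<open>X\<close> (outer) and \<open>Y\<close> (of the coefficients) this is the product of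
  \<open>X - f(x) + x Y\<close>.
\<close>

definition redei :: "('a::{field,finite} \<Rightarrow> 'a) \<Rightarrow> 'a poly poly" where
  "redei f = (\<Prod>x\<in>UNIV. [:- [:f x, - x:], 1:])"

text \<open>
  The recursion between the coefficients \<open>A\<^sub>i\<close> of \<open>X ^ (p ^ i)\<close> in the Redei polynomial. Substituting
  the root \<open>f(x) - x Y\<close> for \<open>X\<close> gives a relation for every \<open>x\<close> in \<open>F\<close>, and both sides are
  linearized in \<open>x\<close>, so coefficients may be compared. As \<open>x ^ (p ^ N) = x\<close>, the terms with \<open>i = 0\<close> and
  with \<open>i = N\<close> fall together; since \<open>A\<^sub>N = 1\<close>, this replaces \<open>A\<^sub>0\<close> by \<open>A\<^sub>0 + 1\<close>.
\<close>

lemma redei_relation: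
  fixes f :: "'a::{field,finite} \<Rightarrow> 'a"
  assumes N: "CARD('a) = CHAR('a) ^ N" and f: "additive_map f"
    and fc: "\<And>x. f x = (\<Sum>t<N. c t * x ^ CHAR('a) ^ t)"
    and B: "\<And>i. B i = coeff (redei f) (CHAR('a) ^ i) + (if i = 0 then 1 else 0)"
    and j: "0 < j" "j < N"
  shows "B j * monom 1 (CHAR('a) ^ j) = (\<Sum>i<N. smult (c ((j + N - i) mod N) ^ CHAR('a) ^ i) (B i))"
proof -
  let ?p = "CHAR('a)"
  have p: "prime ?p" by (rule prime_CHAR_finite)
  have pp: "prime (CHAR('a poly))" using p by simp
  define A where "A i = coeff (redei f) (?p ^ i)" for i
  have N0: "N > 0" using j by simp
  have lin: "linearized (redei f)" unfolding redei_def
  proof (rule linearized_prod)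
    show "additive_map (\<lambda>x. [:f x, - x:])"
      by (simp add: additive_map_def additive_map_add[OF f])
    show "subspace_over prime_subfield (*) (UNIV :: 'a set)" by (rule subspace_over_prime_subfield) auto
  qed simp
  have deg: "degree (redei f) = ?p ^ N"
    unfolding redei_def N[symmetric] by (subst degree_prod_eq_sum_degree) auto
  have "lead_coeff (redei f) = 1" unfolding redei_def by (subst lead_coeff_prod) simp
  then have AN: "A N = 1" by (simp add: A_def deg)
  have "?p ^ N < ?p ^ Suc N" using prime_gt_1_nat[OF p] by simp
  then have R: "redei f = (\<Sum>i<Suc N. monom (A i) (?p ^ i))"
    using linearized_as_sum[OF pp lin, of "Suc N"] deg unfolding A_def by simp
  have key: "(\<Sum>i<Suc N. smult (f x ^ ?p ^ i) (A i)) = (\<Sum>i<Suc N. smult (x ^ ?p ^ i) (A i * monom 1 (?p ^ i)))" for x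
  proof -
    have "poly (redei f) [:f x, - x:] = 0"
      unfolding redei_def poly_prod by (intro prod_zero) (auto intro!: bexI[of _ x])
    then have "(\<Sum>i<Suc N. A i * [:f x, - x:] ^ ?p ^ i) = 0"
      unfolding R poly_sum poly_monom .
    moreover have "A i * [:f x, - x:] ^ ?p ^ i = smult (f x ^ ?p ^ i) (A i) - smult (x ^ ?p ^ i) (A i * monom 1 (?p ^ i))" for i
    proof -
      have "monom (x ^ ?p ^ i) (?p ^ i) = smult (x ^ ?p ^ i) (monom 1 (?p ^ i))"
        by (simp add: smult_monom)
      then show ?thesis by (simp only: linear_poly_power_CHAR right_diff_distrib mult_smult_right)
          (simp add: mult.commute)
    qed
    ultimately show ?thesis by (simp add: sum_subtractf del: sum.lessThan_Suc)
  qed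
  (* The two sides of the relation in key, with the terms for 0 and N merged, are
     linearized in x with coefficients E j and the sums subtracted in G j. *)
  define E where "E i = (if i = 0 then A 0 * monom 1 1 + monom 1 (?p ^ N) else B i * monom 1 (?p ^ i))" for i
  define G where "G j = E j - (\<Sum>i<N. smult (c ((j + N - i) mod N) ^ ?p ^ i) (B i))" for j
  have "(\<Sum>j<N. smult (x ^ ?p ^ j) (G j)) = 0" for x
  proof -
    have xN: "x ^ ?p ^ N = x" for x :: 'a using finite_field_power_CARD[of x] by (simp only: N)
    have "(\<Sum>i<N. smult (f x ^ ?p ^ i) (B i)) = (\<Sum>i<Suc N. smult (f x ^ ?p ^ i) (A i))"
      unfolding sum_lessThan_Suc_merge_ends[OF N0]
      by (intro sum.cong) (simp_all add: B A_def[symmetric] AN xN smult_add_right)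
    also have "\<dots> = (\<Sum>i<N. smult (x ^ ?p ^ i) (E i))"
      unfolding key sum_lessThan_Suc_merge_ends[OF N0]
      by (intro sum.cong) (simp_all add: E_def B A_def[symmetric] AN xN smult_add_right)
    finally have 1: "(\<Sum>i<N. smult (x ^ ?p ^ i) (E i)) = (\<Sum>i<N. smult (f x ^ ?p ^ i) (B i))" by simp
    have "(\<Sum>i<N. smult (f x ^ ?p ^ i) (B i))
        = (\<Sum>i<N. \<Sum>j<N. smult (x ^ ?p ^ j) (smult (c ((j + N - i) mod N) ^ ?p ^ i) (B i)))"
    proof (rule sum.cong)
      fix i assume "i \<in> {..<N}"
      then have "f x ^ ?p ^ i = (\<Sum>j<N. c ((j + N - i) mod N) ^ ?p ^ i * x ^ ?p ^ j)"
        unfolding fc by (intro power_of_power_sum N) simp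
      then show "smult (f x ^ ?p ^ i) (B i)
          = (\<Sum>j<N. smult (x ^ ?p ^ j) (smult (c ((j + N - i) mod N) ^ ?p ^ i) (B i)))"
        by (simp add: smult_sum mult.commute)
    qed simp
    also have "\<dots> = (\<Sum>j<N. smult (x ^ ?p ^ j) (\<Sum>i<N. smult (c ((j + N - i) mod N) ^ ?p ^ i) (B i)))"
      unfolding smult_sum_right by (rule sum.swap)
    finally show ?thesis using 1 by (simp add: G_def smult_diff_right sum_subtractf)
  qed
  then have "G j = 0" by (rule linearized_independent[OF N]) (use j in simp)
  then show ?thesis using j by (simp add: G_def E_def)
qed

text \<open>
  At each point \<open>y\<close> the coefficient is the one of the product for \<open>f - y\<close>, which vanishes whether
  the kernel of \<open>f - y\<close> is trivial or large. The degree of the coefficient is less than \<open>Q\<close>.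
\<close>

lemma redei_coeff_eq_0:
  fixes f :: "'a::{field,finite} \<Rightarrow> 'a"
  assumes f: "additive_map f" and i: "0 < i" "CHAR('a) ^ i < s" "s \<le> CARD('a)"
    and ker: "\<And>a x. x \<noteq> 0 \<Longrightarrow> f x = a * x \<Longrightarrow> s \<le> card {x. f x = a * x}"
  shows "coeff (redei f) (CHAR('a) ^ i) = 0"
proof (rule poly_eq_0_finite_field)
  have "degree (coeff (redei f) (CHAR('a) ^ i)) \<le> CARD('a) - CHAR('a) ^ i"
    unfolding redei_def by (rule degree_coeff_prod_le) auto
  then show "degree (coeff (redei f) (CHAR('a) ^ i)) < CARD('a)"
    using prime_gt_0_nat[OF prime_CHAR_finite[where ?'a = 'a]] finite_UNIV_card_ge_0[where ?'a = 'a]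
    by (meson diff_less finite le_less_trans zero_less_power)
next
  fix y
  define g where "g x = f x - y * x" for x
  have g: "additive_map g" by (simp add: g_def additive_map_def additive_map_add[OF f] algebra_simps)
  have "coeff (\<Prod>x\<in>UNIV. [:- g x, 1:]) (CHAR('a) ^ i) = 0"
  proof (rule coeff_prod_additive_map_eq_0[OF g i(1)])
    assume "{x. g x = 0} \<noteq> {0}"
    then obtain x where "g x = 0" "x \<noteq> 0" using additive_map_0[OF g] by blast
    then have "s \<le> card {x. f x = y * x}" using ker[of x y] by (simp add: g_def)
    then show "CHAR('a) ^ i < card {x. g x = 0}" using i by (simp add: g_def)
  qed (use i in simp)
  then show "poly (coeff (redei f) (CHAR('a) ^ i)) y = 0"
    unfolding redei_def poly_coeff_prod by (simp add: g_def)
qed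

text \<open>
  The factor for \<open>x = 0\<close> is \<open>X\<close>, so the coefficient of \<open>X\<close> is the product of the constant terms
  \<open>x Y - f(x)\<close> of the other factors, each of degree one in \<open>Y\<close>.
\<close>

lemma redei_coeff_1:
  fixes f :: "'a::{field,finite} \<Rightarrow> 'a"
  assumes f: "additive_map f"
  shows "degree (coeff (redei f) 1) = CARD('a) - 1"
proof -
  let ?S = "\<Prod>x\<in>UNIV - {0}. [:- [:f x, - x:], 1:]"
  have "redei f = [:- [:f 0, - 0:], 1:] * ?S"
    unfolding redei_def by (rule prod.remove) auto
  then have "coeff (redei f) 1 = coeff ?S 0"
    by (simp only: coeff_linear_times) (simp add: additive_map_0[OF f])
  then have "coeff (redei f) 1 = (\<Prod>x\<in>UNIV - {0}. - [:f x, - x:])"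
    unfolding poly_0_coeff_0[symmetric] poly_prod by (simp add: poly_0_coeff_0)
  moreover have "degree (\<Prod>x\<in>UNIV - {0}. - [:f x, - x:]) = (\<Sum>x\<in>UNIV - {0::'a}. degree (- [:f x, - x:]))"
    by (rule degree_prod_eq_sum_degree) simp
  moreover have "(\<Sum>x\<in>UNIV - {0::'a}. degree (- [:f x, - x:])) = (\<Sum>x\<in>UNIV - {0::'a}. 1)"
    by (rule sum.cong) auto
  ultimately show ?thesis by (simp add: card_Diff_singleton)
qed

lemma power_power_fixed:
  fixes l :: "'a::monoid_mult"
  assumes "l ^ p ^ D = l" "D dvd t"
  shows "l ^ p ^ t = l"
proof -
  obtain k where t: "t = D * k" using assms(2) by auto
  have "l ^ p ^ (D * k) = l"
  proof (induction k)
    case (Suc k)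
    have "l ^ p ^ (D * Suc k) = (l ^ p ^ D) ^ p ^ (D * k)" by (simp only: mult_Suc_right power_add power_mult)
    then show ?case using assms(1) Suc by simp
  qed simp
  then show ?thesis by (simp add: t)
qed

section \<open>Additive maps with large eigenspaces\<close>

text \<open>
  Without a linear term in \<open>f\<close>, the indices \<open>i\<close> with \<open>B i \<noteq> 0\<close> are closed modulo \<open>N\<close> under adding an
  exponent \<open>t\<close> of \<open>f\<close>: if \<open>B j\<close> were zero for \<open>j = i + t\<close>, the recursion for \<open>j\<close> would be
  a vanishing combination of polynomials of distinct degrees, yet \<open>B i\<close> occurs in it with the nonzero
  factor \<open>c t ^ (p ^ i)\<close>.
\<close>

lemma additive_map_semilinear_no_identity_term:
  fixes f :: "'a::{field,finite} \<Rightarrow> 'a"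
  assumes N: "CARD('a) = CHAR('a) ^ N" and f: "additive_map f"
    and fc: "\<And>x. f x = (\<Sum>t<N. c t * x ^ CHAR('a) ^ t)" and c0: "c 0 = 0"
    and s: "s \<le> CARD('a)"
    and ker: "\<And>a x. x \<noteq> 0 \<Longrightarrow> f x = a * x \<Longrightarrow> s \<le> card {x. f x = a * x}"
  shows "\<exists>D>0. D dvd N \<and> s \<le> CHAR('a) ^ D \<and> (\<forall>l x. l ^ CHAR('a) ^ D = l \<longrightarrow> f (l * x) = l * f x)"
proof -
  let ?p = "CHAR('a)"
  have p: "?p \<ge> 2" using prime_ge_2_nat[OF prime_CHAR_finite] .
  have Q: "CARD('a) > 1" by (rule one_less_CARD_field)
  then have N0: "N > 0" by (cases N) (auto simp: N)
  define B where "B i = coeff (redei f) (?p ^ i) + (if i = 0 then 1 else 0)" for i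
  define \<gamma> where "\<gamma> j i = c ((j + N - i) mod N) ^ ?p ^ i" for j i
  have rel: "B j * monom 1 (?p ^ j) = (\<Sum>i<N. smult (\<gamma> j i) (B i))" if "0 < j" "j < N" for j
    unfolding \<gamma>_def by (rule redei_relation[OF N f fc B_def that])
  have B0: "degree (B 0) = CARD('a) - 1"
  proof -
    have "degree (coeff (redei f) 1 + 1) = degree (coeff (redei f) 1)"
      using redei_coeff_1[OF f] Q by (intro degree_add_eq_left) simp
    then show ?thesis using redei_coeff_1[OF f] by (simp add: B_def)
  qed
  then have B0': "B 0 \<noteq> 0" using Q by auto
  have degB: "degree (B j) < degree (B 0)" if "0 < j" for j
  proof -
    have "degree (B j) \<le> CARD('a) - ?p ^ j"
      using that degree_coeff_prod_le[of UNIV "\<lambda>x. [:f x, - x:]" "?p ^ j"] by (simp add: B_def redei_def)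
    moreover have "1 < ?p ^ j" using that p by (intro one_less_power) auto
    ultimately show ?thesis using B0 Q by linarith
  qed
  have distinct: "i = j" if "i < N" "j < N" "B i \<noteq> 0" "B j \<noteq> 0" "degree (B i) = degree (B j)" for i j
    using distinct_degrees[OF p rel degB that] by blast
  have \<gamma>0: "\<gamma> j i = 0" if j: "0 < j" "j < N" "B j = 0" and i: "i < N" "B i \<noteq> 0" for i j
  proof (rule ccontr)
    assume "\<gamma> j i \<noteq> 0"
    define K where "K = {i. i < N \<and> \<gamma> j i \<noteq> 0 \<and> B i \<noteq> 0}"
    have K: "finite K" "K \<noteq> {}" using i \<open>\<gamma> j i \<noteq> 0\<close> by (auto simp: K_def)
    then obtain m where m: "m \<in> K" "\<And>k. k \<in> K \<Longrightarrow> degree (B k) \<le> degree (B m)"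
      using obtains_MAX[OF K, of "\<lambda>i. degree (B i)"] by (metis Max_ge finite_imageI imageI)
    have "(\<Sum>i<N. smult (\<gamma> j i) (B i)) \<noteq> 0"
    proof (rule poly_sum_distinct_degrees(2))
      fix k assume k: "k \<in> {..<N}" "k \<noteq> m" "\<gamma> j k \<noteq> 0" "B k \<noteq> 0"
      then have "degree (B k) \<le> degree (B m)" using m(2)[of k] by (simp add: K_def)
      moreover have "degree (B k) \<noteq> degree (B m)" using distinct[of k m] k m(1) by (auto simp: K_def)
      ultimately show "degree (B k) < degree (B m)" by simp
    qed (use m(1) in \<open>auto simp: K_def\<close>)
    then show False using rel[OF j(1,2)] j(3) by simp
  qed
  (* Starting from the nonzero B 0, the shifts by exponents of f lead to the index D. *)
  define supp where "supp = {t. t < N \<and> c t \<noteq> 0}"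
  define D where "D = Gcd (insert N supp)"
  have BD: "B (D mod N) \<noteq> 0" unfolding D_def
  proof (rule Gcd_shift_closed[OF N0])
    fix s t assume s: "s \<in> supp" and t: "B (t mod N) \<noteq> 0"
    let ?i = "t mod N" and ?j = "(t + s) mod N"
    have j: "?j = (?i + s) mod N" by (simp add: mod_add_left_eq)
    have "(?j + N - ?i) mod N = s" unfolding j using N0 s by (intro add_mod_diff_cancel) (auto simp: supp_def)
    then have "\<gamma> ?j ?i \<noteq> 0" using s by (simp add: \<gamma>_def supp_def)
    then show "B ?j \<noteq> 0" using \<gamma>0[of ?j ?i] t B0' N0 by (cases "?j = 0") auto
  qed (use B0' in \<open>auto simp: supp_def\<close>)
  have DN: "D dvd N" unfolding D_def by (rule Gcd_dvd) simp
  have D0: "D > 0" using dvd_pos_nat[OF N0 DN] .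
  have "s \<le> ?p ^ D"
  proof (cases "D = N")
    case True
    then show ?thesis using s N by simp
  next
    case False
    then have "D < N" using dvd_imp_le[OF DN N0] False by simp
    then have nz: "coeff (redei f) (?p ^ D) \<noteq> 0" using BD D0 by (simp add: B_def)
    show ?thesis
    proof (rule leI, rule notI)
      assume "?p ^ D < s"
      then have "coeff (redei f) (?p ^ D) = 0" by (rule redei_coeff_eq_0[OF f D0 _ s ker])
      with nz show False by simp
    qed
  qed
  moreover have "f (l * x) = l * f x" if l: "l ^ ?p ^ D = l" for l x
  proof -
    have "c t * (l * x) ^ ?p ^ t = l * (c t * x ^ ?p ^ t)" if "t < N" for t
    proof (cases "c t = 0")
      case False
      then have "D dvd t" using that unfolding D_def by (intro Gcd_dvd) (simp add: supp_def)
      then show ?thesis using power_power_fixed[OF l] by (simp add: power_mult_distrib)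
    qed simp
    then show ?thesis unfolding fc sum_distrib_left by (intro sum.cong) auto
  qed
  ultimately show ?thesis using D0 DN by blast
qed

text \<open>
  Subtracting the linear term from \<open>f\<close> only shifts the eigenvalues \<open>a\<close>.
\<close>

theorem additive_map_semilinear:
  fixes f :: "'a::{field,finite} \<Rightarrow> 'a"
  assumes N: "CARD('a) = CHAR('a) ^ N" and f: "additive_map f" and s: "s \<le> CARD('a)"
    and ker: "\<And>a x. x \<noteq> 0 \<Longrightarrow> f x = a * x \<Longrightarrow> s \<le> card {x. f x = a * x}"
  shows "\<exists>D>0. D dvd N \<and> s \<le> CHAR('a) ^ D \<and> (\<forall>l x. l ^ CHAR('a) ^ D = l \<longrightarrow> f (l * x) = l * f x)"
proof -
  let ?p = "CHAR('a)"
  obtain c where fc: "\<And>x. f x = (\<Sum>t<N. c t * x ^ ?p ^ t)"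
    using additive_map_as_sum[OF N f] by blast
  define g where "g x = f x - c 0 * x" for x
  have N0: "N > 0"
    using one_less_CARD_field[where ?'a = 'a] by (cases N) (auto simp: N)
  have "\<exists>D>0. D dvd N \<and> s \<le> ?p ^ D \<and> (\<forall>l x. l ^ ?p ^ D = l \<longrightarrow> g (l * x) = l * g x)"
  proof (rule additive_map_semilinear_no_identity_term[OF N _ _ _ s, where c = "c(0 := 0)"])
    show "additive_map g" by (simp add: g_def additive_map_def additive_map_add[OF f] algebra_simps)
    show "g x = (\<Sum>t<N. (c(0 := 0)) t * x ^ ?p ^ t)" for x
      using N0 by (simp add: g_def fc sum.remove[of "{..<N}" 0])
    show "s \<le> card {x. g x = a * x}" if "x \<noteq> 0" "g x = a * x" for a x
      using ker[of x "a + c 0"] that by (simp add: g_def algebra_simps)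
  qed simp
  then obtain D where D: "D > 0" "D dvd N" "s \<le> ?p ^ D"
    and lin: "\<And>l x. l ^ ?p ^ D = l \<Longrightarrow> g (l * x) = l * g x" by blast
  have "f (l * x) = l * f x" if "l ^ ?p ^ D = l" for l x
  proof -
    have "f (l * x) - c 0 * (l * x) = l * (f x - c 0 * x)" using lin[OF that] by (simp only: g_def)
    then have "f (l * x) - c 0 * (l * x) = l * f x - c 0 * (l * x)"
      by (simp only: right_diff_distrib mult.left_commute)
    then show ?thesis by simp
  qed
  with D show ?thesis by blast
qed

section \<open>Trace duality\<close>

text \<open>
  The absolute trace of the field if its order is the \<open>N\<close>-th power of the characteristic.
\<close>

definition frob_trace :: "nat \<Rightarrow> 'a::{field,finite} \<Rightarrow> 'a" where
  "frob_trace N x = (\<Sum>i<N. x ^ CHAR('a) ^ i)"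

lemma additive_map_frob_trace: "additive_map (frob_trace N :: 'a::{field,finite} \<Rightarrow> 'a)"
  unfolding additive_map_def frob_trace_def
  by (simp add: freshmans_dream'[OF prime_CHAR_finite refl] sum.distrib)

text \<open>
  Values in the prime field mean \<open>\<psi>(x) ^ p = \<psi>(x)\<close>. Comparing coefficients of the linearized
  polynomial, each coefficient is the \<open>p\<close>-th power of the preceding one, so the first determines all.
\<close>

lemma frob_trace_represents:
  fixes \<psi> :: "'a::{field,finite} \<Rightarrow> 'a"
  assumes N: "CARD('a) = CHAR('a) ^ N" and \<psi>: "additive_map \<psi>"
    and prim: "\<And>x. \<psi> x ^ CHAR('a) = \<psi> x"
  shows "\<exists>b. \<forall>x. \<psi> x = frob_trace N (b * x)"
proof -
  let ?p = "CHAR('a)"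
  obtain c where \<psi>c: "\<And>x. \<psi> x = (\<Sum>t<N. c t * x ^ ?p ^ t)"
    using additive_map_as_sum[OF N \<psi>] by blast
  have step: "c (Suc j) = c j ^ ?p" if "Suc j < N" for j
  proof -
    define G where "G j = [:c j - c ((j + N - 1) mod N) ^ ?p:]" for j
    have add: "additive_map (\<lambda>x::'a. [:x:])" by (simp add: additive_map_def)
    have "(\<Sum>j<N. smult (x ^ ?p ^ j) (G j)) = 0" for x
    proof -
      have "(\<Sum>j<N. smult (x ^ ?p ^ j) (G j))
          = [:\<Sum>j<N. c j * x ^ ?p ^ j - c ((j + N - 1) mod N) ^ ?p * x ^ ?p ^ j:]"
        by (simp add: additive_map_sum[OF add] G_def algebra_simps)
      also have "(\<Sum>j<N. c j * x ^ ?p ^ j - c ((j + N - 1) mod N) ^ ?p * x ^ ?p ^ j) = \<psi> x - \<psi> x ^ ?p"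
        using power_of_power_sum[OF N, of 1 c x] that unfolding \<psi>c sum_subtractf by simp
      finally show ?thesis by (simp add: prim)
    qed
    then have "G (Suc j) = 0" by (rule linearized_independent[OF N _ that])
    then show ?thesis using that by (simp add: G_def)
  qed
  have cj: "c j = c 0 ^ ?p ^ j" if "j < N" for j
    using that
  proof (induction j)
    case (Suc j)
    then have "c (Suc j) = (c 0 ^ ?p ^ j) ^ ?p" using step[of j] by simp
    then show ?case by (simp only: power_Suc2 power_mult)
  qed simp
  have "\<psi> x = frob_trace N (c 0 * x)" for x
    unfolding \<psi>c frob_trace_def power_mult_distrib
    by (rule sum.cong[OF refl], subst cj) simp_all
  then show ?thesis by blast
qed

text \<open>
  Take a maximal \<open>L\<close>-subspace \<open>M\<close> that contains \<open>G\<close> but not \<open>z\<close>. Adjoining any further vector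
  reaches \<open>z\<close>, hence \<open>V = M + L z\<close>, and \<open>\<psi>\<close> is the coordinate along \<open>z\<close>.
\<close>

lemma separating_functional:
  fixes scale :: "'a::field \<Rightarrow> 'v::ab_group_add \<Rightarrow> 'v"
  assumes vs: "vector_space scale" and L: "subfield_set L" and fin: "finite (UNIV :: 'v set)"
    and G: "subspace_over L scale G" and z: "z \<notin> G"
  shows "\<exists>\<psi>. additive_map \<psi> \<and> range \<psi> \<subseteq> L \<and> (\<forall>k\<in>L. \<forall>x. \<psi> (scale k x) = k * \<psi> x) \<and>
     (\<forall>x\<in>G. \<psi> x = 0) \<and> \<psi> z = 1"
proof -
  interpret vector_space scale by fact
  define F where "F = {M. subspace_over L scale M \<and> G \<subseteq> M \<and> z \<notin> M}"
  have "G \<in> F" using G z by (simp add: F_def)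
  moreover have "finite F"
    using fin[THEN finite_Pow_iff[THEN iffD2]] by (rule rev_finite_subset) simp
  ultimately obtain M where M: "M \<in> F" and max: "\<And>M'. M' \<in> F \<Longrightarrow> M \<subseteq> M' \<Longrightarrow> M = M'"
    using finite_has_maximal2 by metis
  have sM: "subspace_over L scale M" and zM: "z \<notin> M" and GM: "G \<subseteq> M" using M by (auto simp: F_def)
  have ex: "\<exists>m\<in>M. \<exists>k\<in>L. v = m + scale k z" for v
  proof (cases "v \<in> M")
    case True
    then show ?thesis using L by (intro bexI[of _ v] bexI[of _ 0]) (auto simp: subfield_set_def)
  next
    case False
    have "z \<in> adjoin L scale M v"
    proof (rule ccontr)
      assume "z \<notin> adjoin L scale M v"
      then have "adjoin L scale M v \<in> F"
        using subspace_over_adjoin[OF vs L sM] order.trans[OF GM adjoin_superset(1)[OF vs L sM]]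
        by (simp add: F_def)
      then show False using max adjoin_superset[OF vs L sM] False by blast
    qed
    then obtain m k where mk: "m \<in> M" "k \<in> L" "z = m + scale k v" by (auto simp: adjoin_def)
    have "k \<noteq> 0" using mk zM by auto
    then have "v = scale (inverse k) (scale k v)" by simp
    also have "scale k v = z - m" using mk(3) by simp
    finally have "v = scale (- inverse k) m + scale (inverse k) z"
      by (simp add: scale_right_diff_distrib)
    moreover have "inverse k \<in> L" "- inverse k \<in> L" using mk(2) L by (auto simp: subfield_set_def)
    moreover have "scale (- inverse k) m \<in> M" using \<open>- inverse k \<in> L\<close> mk(1) sM
      unfolding subspace_over_def by blast
    ultimately show ?thesis by blast
  qed
  define \<psi> where "\<psi> v = (SOME k. k \<in> L \<and> (\<exists>m\<in>M. v = m + scale k z))" for v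
  have eq: "\<psi> (m + scale k z) = k" if "m \<in> M" "k \<in> L" for m k
  proof -
    have "\<psi> (m + scale k z) \<in> L \<and> (\<exists>m'\<in>M. m + scale k z = m' + scale (\<psi> (m + scale k z)) z)"
      unfolding \<psi>_def[of "m + scale k z"] by (rule someI[of _ k]) (use that in auto)
    then obtain m' where "m' \<in> M" "\<psi> (m + scale k z) \<in> L" "m + scale k z = m' + scale (\<psi> (m + scale k z)) z"
      by blast
    then show ?thesis
      using inj_onD[OF inj_on_adjoin[OF vs L sM zM], of "(m, k)" "(m', \<psi> (m + scale k z))"] that by auto
  qed
  have "additive_map \<psi>" unfolding additive_map_def
  proof (intro allI)
    fix x y
    obtain m k m' k' where *: "m \<in> M" "k \<in> L" "x = m + scale k z" "m' \<in> M" "k' \<in> L" "y = m' + scale k' z"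
      using ex by metis
    have "x + y = (m + m') + scale (k + k') z" using * by (simp add: algebra_simps)
    moreover have "m + m' \<in> M" "k + k' \<in> L" using * sM L by (auto simp: subspace_over_def subfield_set_def)
    ultimately show "\<psi> (x + y) = \<psi> x + \<psi> y" using * eq by metis
  qed
  moreover have "range \<psi> \<subseteq> L" using ex eq by (metis image_subsetI)
  moreover have "\<psi> (scale l x) = l * \<psi> x" if "l \<in> L" for l x
  proof -
    obtain m k where *: "m \<in> M" "k \<in> L" "x = m + scale k z" using ex by metis
    have "scale l x = scale l m + scale (l * k) z" using * by (simp add: algebra_simps)
    moreover have "scale l m \<in> M" "l * k \<in> L" using * sM L that by (auto simp: subspace_over_def subfield_set_def)
    ultimately show ?thesis using * eq by metis
  qed
  moreover have "\<psi> x = 0" if "x \<in> G" for x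
    using eq[of x 0] that GM L by (auto simp: subfield_set_def)
  moreover have "\<psi> z = 1"
    using eq[of 0 1] sM L by (auto simp: subfield_set_def subspace_over_def)
  ultimately show ?thesis by blast
qed

lemma prime_subfield_power: "x \<in> prime_subfield \<Longrightarrow> x ^ CHAR('a) = (x :: 'a::{field,finite})"
  by (auto simp: prime_subfield_def power_CHAR_of_nat[OF prime_CHAR_finite])

text \<open>
  Otherwise the trace would vanish identically, and with it every additive map into the prime
  field, since all of these are given by the trace.
\<close>

lemma frob_trace_nondegenerate:
  fixes b :: "'a::{field,finite}"
  assumes N: "CARD('a) = CHAR('a) ^ N" and eq: "\<And>x. frob_trace N (b * x) = frob_trace N (c * x)"
  shows "b = c"
proof (rule ccontr)
  assume "b \<noteq> c"
  note tr = additive_map_frob_trace[where ?'a = 'a]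
  have zero: "frob_trace N y = 0" for y :: 'a
  proof -
    have "frob_trace N ((b - c) * (y / (b - c))) = 0"
      using eq by (simp only: left_diff_distrib additive_map_diff[OF tr]) simp
    then show ?thesis using \<open>b \<noteq> c\<close> by simp
  qed
  have "subspace_over prime_subfield (*) {0::'a}" by (rule subspace_over_prime_subfield) auto
  then obtain \<psi> where \<psi>: "additive_map \<psi>" "range \<psi> \<subseteq> prime_subfield" "\<psi> (1::'a) = (1::'a)"
    using separating_functional[OF vector_space_field subfield_prime_subfield, of "{0::'a}" 1] by auto
  have "\<psi> x ^ CHAR('a) = \<psi> x" for x using \<psi>(2) by (intro prime_subfield_power) auto
  then obtain e where "\<psi> 1 = frob_trace N (e * 1)"
    using frob_trace_represents[OF N \<psi>(1)] by blast
  then show False using zero \<psi>(3) by simp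
qed

definition functional :: "('a::field \<Rightarrow> 'v::ab_group_add \<Rightarrow> 'v) \<Rightarrow> ('v \<Rightarrow> 'a) \<Rightarrow> bool" where
  "functional scale \<mu> \<longleftrightarrow> additive_map \<mu> \<and> (\<forall>c x. \<mu> (scale c x) = c * \<mu> x)"

text \<open>
  On each line through a vector \<open>x\<close> the map \<open>\<Psi>\<close> is given by the trace and a unique factor,
  which is taken as \<open>\<mu> x\<close>; linearity follows from uniqueness.
\<close>

lemma frob_trace_lift:
  fixes scale :: "'a::{field,finite} \<Rightarrow> 'v::ab_group_add \<Rightarrow> 'v"
  assumes vs: "vector_space scale" and N: "CARD('a) = CHAR('a) ^ N"
    and \<Psi>: "additive_map \<Psi>" "\<And>x. \<Psi> x ^ CHAR('a) = \<Psi> x"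
  shows "\<exists>\<mu>. functional scale \<mu> \<and> (\<forall>x. \<Psi> x = frob_trace N (\<mu> x))"
proof -
  interpret vector_space scale by fact
  note tr = additive_map_frob_trace[where ?'a = 'a]
  have "\<exists>b. \<forall>t. \<Psi> (scale t x) = frob_trace N (b * t)" for x
    by (rule frob_trace_represents[OF N])
      (auto simp: additive_map_def scale_left_distrib additive_map_add[OF \<Psi>(1)] \<Psi>(2))
  then obtain \<mu> where \<mu>: "\<And>x t. \<Psi> (scale t x) = frob_trace N (\<mu> x * t)" by metis
  have "\<mu> (x + y) = \<mu> x + \<mu> y" for x y
  proof (rule frob_trace_nondegenerate[OF N])
    show "frob_trace N (\<mu> (x + y) * t) = frob_trace N ((\<mu> x + \<mu> y) * t)" for t
      by (simp add: \<mu>[symmetric] scale_right_distrib additive_map_add[OF \<Psi>(1)]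
        distrib_right additive_map_add[OF tr])
  qed
  moreover have "\<mu> (scale c x) = c * \<mu> x" for c x
  proof (rule frob_trace_nondegenerate[OF N])
    fix t
    have "frob_trace N (\<mu> (scale c x) * t) = \<Psi> (scale (t * c) x)" by (simp add: \<mu>[symmetric])
    also have "\<dots> = frob_trace N (c * \<mu> x * t)" unfolding \<mu> by (simp add: mult_ac)
    finally show "frob_trace N (\<mu> (scale c x) * t) = frob_trace N (c * \<mu> x * t)" .
  qed
  moreover have "\<Psi> x = frob_trace N (\<mu> x)" for x using \<mu>[of 1 x] by simp
  ultimately show ?thesis unfolding functional_def additive_map_def by blast
qed

text \<open>
  Here the condition on hyperplane sections of \<open>U\<close> becomes a condition on eigenspaces of
  \<open>f(t) = \<mu>(\<rho>(t v))\<close>. If \<open>f - a\<close> is not injective, it is not onto, so some \<open>tr(b \<cdot>)\<close> with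
  \<open>b \<noteq> 0\<close> kills its image. The additive map \<open>tr(b \<mu>(\<rho> x))\<close> has the form \<open>tr(b l(x))\<close> for
  a linear functional \<open>l\<close>. Nondegeneracy of the trace shows that \<open>l\<close> agrees with \<open>\<mu>\<close> on \<open>C\<close>
  and that \<open>l v = a\<close>. Therefore \<open>f(t) - a t = l(\<rho>(t v) - t v)\<close> lies in \<open>l ` U\<close>. Moreover
  \<open>tr(b \<cdot>)\<close> vanishes on \<open>l ` U\<close> as \<open>\<rho>\<close> does on \<open>U\<close>, so \<open>l ` U\<close> is not \<open>F\<close> and has at
  most \<open>Q / s\<close> elements, and the kernel of \<open>f - a\<close> has at least \<open>s\<close>.
\<close>

lemma eigen_kernel_bound:
  fixes scale :: "'a::{field,finite} \<Rightarrow> 'v::ab_group_add \<Rightarrow> 'v"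
  assumes vs: "vector_space scale" and N: "CARD('a) = CHAR('a) ^ N"
    and U: "0 \<in> U" "\<And>x y. x \<in> U \<Longrightarrow> y \<in> U \<Longrightarrow> x - y \<in> U" "finite U"
    and C: "\<And>t c. c \<in> C \<Longrightarrow> scale t c \<in> C"
    and \<rho>: "additive_map \<rho>" "\<And>v. \<rho> v \<in> C" "\<And>v. v - \<rho> v \<in> U" "\<And>u. u \<in> U \<Longrightarrow> \<rho> u = 0"
      "\<And>c. c \<in> C \<Longrightarrow> \<rho> c = c"
    and hyp: "\<And>\<mu>. functional scale \<mu> \<Longrightarrow> \<mu> ` U \<noteq> UNIV \<Longrightarrow> card (\<mu> ` U) * s \<le> CARD('a)"
    and \<mu>: "functional scale \<mu>" and t0: "t0 \<noteq> 0" "\<mu> (\<rho> (scale t0 v)) = a * t0"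
  shows "s \<le> card {t. \<mu> (\<rho> (scale t v)) = a * t}"
proof -
  interpret vector_space scale by fact
  note tr = additive_map_frob_trace[where ?'a = 'a]
  have \<mu>': "additive_map \<mu>" "\<And>c x. \<mu> (scale c x) = c * \<mu> x" using \<mu> by (auto simp: functional_def)
  define g where "g t = \<mu> (\<rho> (scale t v)) - a * t" for t
  have g: "additive_map g"
    by (simp add: additive_map_def g_def scale_left_distrib additive_map_add[OF \<rho>(1)]
      additive_map_add[OF \<mu>'(1)] algebra_simps)
  have rk: "card (range g) * card {t. g t = 0} = CARD('a)" by (rule card_range_ker[OF g])
  have "range g \<noteq> UNIV"
  proof
    assume "range g = UNIV"
    then have "card {t. g t = 0} = 1" using rk finite_UNIV_card_ge_0[where ?'a = 'a] by simp
    moreover have "card {0, t0} \<le> card {t. g t = 0}"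
      using t0(2) additive_map_0[OF g] by (intro card_mono) (auto simp: g_def)
    ultimately show False using t0(1) by simp
  qed
  then obtain z where z: "z \<notin> range g" by auto
  have "subspace_over prime_subfield (*) (range g)"
  proof (rule subspace_over_prime_subfield)
    show "0 \<in> range g" using additive_map_0[OF g] by (metis rangeI)
    show "x + y \<in> range g" if "x \<in> range g" "y \<in> range g" for x y
      using that additive_map_add[OF g] by (metis (no_types, lifting) imageE rangeI)
  qed
  from separating_functional[OF vector_space_field subfield_prime_subfield finite this z]
  obtain \<psi> where \<psi>: "additive_map \<psi>" "range \<psi> \<subseteq> prime_subfield" "\<forall>x\<in>range g. \<psi> x = 0" "\<psi> z = (1::'a)"
    by blast
  have prim: "\<psi> x ^ CHAR('a) = \<psi> x" for x
    using \<psi>(2) by (intro prime_subfield_power) auto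
  obtain b where b: "\<And>x. \<psi> x = frob_trace N (b * x)"
    using frob_trace_represents[OF N \<psi>(1) prim] by blast
  have b0: "b \<noteq> 0"
  proof
    assume "b = 0"
    then have "\<psi> z = 0" unfolding b by (simp add: additive_map_0[OF tr])
    with \<psi>(4) show False by simp
  qed
  have "\<exists>\<nu>. functional scale \<nu> \<and> (\<forall>x. \<psi> (\<mu> (\<rho> x)) = frob_trace N (\<nu> x))"
    by (rule frob_trace_lift[OF vs N])
      (simp_all add: additive_map_def additive_map_add[OF \<rho>(1)] additive_map_add[OF \<mu>'(1)]
        additive_map_add[OF \<psi>(1)] prim)
  then obtain \<nu> where \<nu>: "additive_map \<nu>" "\<And>c x. \<nu> (scale c x) = c * \<nu> x"
    "\<And>x. \<psi> (\<mu> (\<rho> x)) = frob_trace N (\<nu> x)" by (auto simp: functional_def)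
  define l where "l x = \<nu> x / b" for x
  have l: "functional scale l"
    by (simp add: functional_def additive_map_def l_def additive_map_add[OF \<nu>(1)] \<nu>(2) add_divide_distrib)
  have l': "additive_map l" "\<And>c x. l (scale c x) = c * l x" using l by (auto simp: functional_def)
  have tl: "\<psi> (l x) = \<psi> (\<mu> (\<rho> x))" for x
  proof -
    have "\<psi> (l x) = frob_trace N (\<nu> x)" unfolding b l_def using b0 by simp
    then show ?thesis by (simp only: \<nu>(3))
  qed
  have lC: "l c = \<mu> c" if "c \<in> C" for c
  proof -
    have "b * l c = b * \<mu> c"
    proof (rule frob_trace_nondegenerate[OF N])
      fix t
      have "\<psi> (l (scale t c)) = \<psi> (\<mu> (scale t c))" unfolding tl using \<rho>(5) C[OF that] by simp
      then show "frob_trace N (b * l c * t) = frob_trace N (b * \<mu> c * t)"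
        unfolding l' \<mu>' b by (simp add: mult_ac)
    qed
    then show ?thesis using b0 by simp
  qed
  have lv: "l v = a"
  proof -
    have "b * l v = b * a"
    proof (rule frob_trace_nondegenerate[OF N])
      fix t
      have "\<psi> (\<mu> (\<rho> (scale t v)) - a * t) = 0" using \<psi>(3) by (auto simp: g_def)
      then have "\<psi> (l (scale t v)) = \<psi> (a * t)" unfolding tl by (simp add: additive_map_diff[OF \<psi>(1)])
      then show "frob_trace N (b * l v * t) = frob_trace N (b * a * t)"
        unfolding l' b by (simp add: mult_ac)
    qed
    then show ?thesis using b0 by simp
  qed
  have "\<psi> (l u) = 0" if "u \<in> U" for u
    unfolding tl \<rho>(4)[OF that] by (simp add: additive_map_0[OF \<mu>'(1)] additive_map_0[OF \<psi>(1)])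
  then have "z \<notin> l ` U" using \<psi>(4) by auto
  then have "card (l ` U) * s \<le> CARD('a)" using hyp[OF l] by blast
  moreover have "range g \<subseteq> l ` U"
  proof (rule image_subsetI)
    fix t
    have "g t = l (\<rho> (scale t v)) - l (scale t v)"
      unfolding g_def lC[OF \<rho>(2)] l' lv by (simp add: mult.commute)
    also have "\<dots> = l (0 - (scale t v - \<rho> (scale t v)))" by (simp add: additive_map_diff[OF l'(1)])
    finally show "g t \<in> l ` U" using U(1,2) \<rho>(3) by (metis imageI)
  qed
  then have "card (range g) \<le> card (l ` U)" using U(3) by (intro card_mono) auto
  ultimately have "card (range g) * s \<le> card (range g) * card {t. g t = 0}"
    unfolding rk by (meson mult_le_mono1 le_trans)
  then have "s \<le> card {t. g t = 0}" by (simp add: card_gt_0_iff)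
  then show ?thesis by (simp add: g_def)
qed

section \<open>One subfield for all functionals\<close>

text \<open>
  A space over a field with \<open>Q\<close> elements is not a union of at most \<open>Q\<close> proper subspaces. Think of
  \<open>line x a y\<close> as \<open>x + a y\<close>. If \<open>y\<close> lies in \<open>M D\<close> only and \<open>x\<close> does not lie in \<open>M D\<close>, then none of
  the \<open>Q\<close> vectors \<open>x + a y\<close> does, so two of them lie in the same other subspace, which then contains
  \<open>y\<close>. The abstract form serves both for vectors and for functionals, which do not form a type of
  vectors.
\<close>

lemma not_union_of_few_subspaces:
  fixes line :: "'x \<Rightarrow> 'a::finite \<Rightarrow> 'x \<Rightarrow> 'x"
  assumes "finite \<D>" "card \<D> \<le> CARD('a)" "W \<noteq> {}"
    and cover: "\<And>x. x \<in> W \<Longrightarrow> \<exists>D\<in>\<D>. M D x"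
    and line: "\<And>x a y. x \<in> W \<Longrightarrow> y \<in> W \<Longrightarrow> line x a y \<in> W"
    and M1: "\<And>D x a y. x \<in> W \<Longrightarrow> y \<in> W \<Longrightarrow> M D y \<Longrightarrow> M D (line x a y) \<Longrightarrow> M D x"
    and M2: "\<And>D x a b y. x \<in> W \<Longrightarrow> y \<in> W \<Longrightarrow> a \<noteq> b \<Longrightarrow> M D (line x a y) \<Longrightarrow> M D (line x b y) \<Longrightarrow> M D y"
  shows "\<exists>D\<in>\<D>. \<forall>x\<in>W. M D x"
  using assms(1,2) cover
proof (induction \<D> rule: finite_induct)
  case empty
  then show ?case using \<open>W \<noteq> {}\<close> by auto
next
  case (insert D \<D>)
  show ?case
  proof (cases "\<forall>x\<in>W. \<exists>E\<in>\<D>. M E x")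
    case True
    then show ?thesis using insert by fastforce
  next
    case False
    then obtain y where y: "y \<in> W" "\<And>E. E \<in> \<D> \<Longrightarrow> \<not> M E y" by blast
    then have yD: "M D y" using insert.prems(2) by blast
    have "M D x" if x: "x \<in> W" for x
    proof (rule ccontr)
      assume nx: "\<not> M D x"
      have "\<exists>E\<in>\<D>. M E (line x a y)" for a
        using insert.prems(2)[OF line[OF x y(1)], of a] M1[OF x y(1) yD, of a] nx by auto
      then obtain E where E: "\<And>a. E a \<in> \<D>" "\<And>a. M (E a) (line x a y)" by metis
      have "\<not> inj E"
      proof
        assume "inj E"
        then have "CARD('a) \<le> card \<D>" using E(1) insert.hyps(1) by (intro card_inj_on_le) auto
        then show False using insert.prems(1) insert.hyps by simp
      qed
      then obtain a b where "a \<noteq> b" "E a = E b" by (auto simp: inj_def)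
      then have "M (E a) y" using M2[OF x y(1), of a b "E a"] E by metis
      then show False using y(2) E(1) by blast
    qed
    then show ?thesis by blast
  qed
qed

lemma uniform_semilinear:
  fixes scale :: "'a::{field,finite} \<Rightarrow> 'v::ab_group_add \<Rightarrow> 'v"
  assumes vs: "vector_space scale" and fin: "finite (UNIV :: 'v set)" and N: "CARD('a) = CHAR('a) ^ N"
    and U: "0 \<in> U" "\<And>x y. x \<in> U \<Longrightarrow> y \<in> U \<Longrightarrow> x - y \<in> U"
    and C: "\<And>t c. c \<in> C \<Longrightarrow> scale t c \<in> C"
    and \<rho>: "additive_map \<rho>" "\<And>v. \<rho> v \<in> C" "\<And>v. v - \<rho> v \<in> U" "\<And>u. u \<in> U \<Longrightarrow> \<rho> u = 0"
      "\<And>c. c \<in> C \<Longrightarrow> \<rho> c = c"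
    and s: "s \<le> CARD('a)"
    and hyp: "\<And>\<mu>. functional scale \<mu> \<Longrightarrow> \<mu> ` U \<noteq> UNIV \<Longrightarrow> card (\<mu> ` U) * s \<le> CARD('a)"
  shows "\<exists>D>0. D dvd N \<and> s \<le> CHAR('a) ^ D \<and>
      (\<forall>l v. l ^ CHAR('a) ^ D = l \<longrightarrow> \<rho> (scale l v) = scale l (\<rho> v))"
proof -
  interpret vector_space scale by fact
  let ?p = "CHAR('a)"
  have finU: "finite U" using fin by (rule rev_finite_subset) simp
  have N0: "N > 0"
    using one_less_CARD_field[where ?'a = 'a] by (cases N) (auto simp: N)
  define \<D> where "\<D> = {D. 0 < D \<and> D dvd N \<and> s \<le> ?p ^ D}"
  have sub: "\<D> \<subseteq> {1..N}" using N0 by (auto simp: \<D>_def dvd_imp_le)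
  then have fin\<D>: "finite \<D>" using finite_subset by blast
  have "card \<D> \<le> card {1..N}" using sub by (intro card_mono) simp_all
  also have "\<dots> < 2 ^ N" by simp
  also have "\<dots> \<le> ?p ^ N" using prime_ge_2_nat[OF prime_CHAR_finite[where ?'a = 'a]] by (rule power_mono) simp
  finally have card\<D>: "card \<D> \<le> CARD('a)" by (simp add: N)
  (* The defect of linearity; it is additive in the functional and in the vector. *)
  define \<delta> where "\<delta> l t \<mu> v = \<mu> (\<rho> (scale (l * t) v)) - l * \<mu> (\<rho> (scale t v))" for l t \<mu> v
  define M where "M D \<mu> v \<longleftrightarrow> (\<forall>l t. l ^ ?p ^ D = l \<longrightarrow> \<delta> l t \<mu> v = 0)" for D \<mu> v
  have f0: "functional scale (\<lambda>_. 0)" by (simp add: functional_def additive_map_def)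
  have each: "\<exists>D\<in>\<D>. M D \<mu> v" if \<mu>: "functional scale \<mu>" for \<mu> v
  proof -
    have \<mu>': "additive_map \<mu>" using \<mu> by (simp add: functional_def)
    define f where "f t = \<mu> (\<rho> (scale t v))" for t
    have "\<exists>D>0. D dvd N \<and> s \<le> ?p ^ D \<and> (\<forall>l x. l ^ ?p ^ D = l \<longrightarrow> f (l * x) = l * f x)"
    proof (rule additive_map_semilinear[OF N _ s])
      show "additive_map f"
        by (simp add: additive_map_def f_def scale_left_distrib additive_map_add[OF \<rho>(1)] additive_map_add[OF \<mu>'])
      show "s \<le> card {x. f x = a * x}" if "x \<noteq> 0" "f x = a * x" for a x
        unfolding f_def by (rule eigen_kernel_bound[OF vs N U finU C \<rho> hyp \<mu> that(1)])
          (use that(2) in \<open>simp_all add: f_def\<close>)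
    qed
    then obtain D where "0 < D" "D dvd N" "s \<le> ?p ^ D"
      "\<And>l x. l ^ ?p ^ D = l \<Longrightarrow> f (l * x) = l * f x" by blast
    then show ?thesis by (intro bexI[of _ D]) (simp_all add: M_def \<delta>_def f_def \<D>_def)
  qed
  have all_\<mu>: "\<exists>D\<in>\<D>. \<forall>\<mu>\<in>{\<mu>. functional scale \<mu>}. M D \<mu> v" for v
  proof (rule not_union_of_few_subspaces[OF fin\<D> card\<D>, where line = "\<lambda>\<mu> a \<nu> x. \<mu> x + a * \<nu> x"])
    show "{\<mu>. functional scale \<mu>} \<noteq> {}" using f0 by blast
  next
    show "\<exists>D\<in>\<D>. M D \<mu> v" if "\<mu> \<in> {\<mu>. functional scale \<mu>}" for \<mu> using each that by simp
  next
    fix \<mu> a \<nu> assume "\<mu> \<in> {\<mu>. functional scale \<mu>}" "\<nu> \<in> {\<mu>. functional scale \<mu>}"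
    then show "(\<lambda>x. \<mu> x + a * \<nu> x) \<in> {\<mu>. functional scale \<mu>}"
      by (simp add: functional_def additive_map_def algebra_simps)
  next
    fix D \<mu> a \<nu>
    assume "M D \<nu> v" "M D (\<lambda>x. \<mu> x + a * \<nu> x) v"
    moreover have "\<delta> l t (\<lambda>x. \<mu> x + a * \<nu> x) v = \<delta> l t \<mu> v + a * \<delta> l t \<nu> v" for l t
      by (simp add: \<delta>_def algebra_simps)
    ultimately show "M D \<mu> v" by (simp add: M_def)
  next
    fix D \<mu> a b \<nu>
    assume ab: "a \<noteq> (b::'a)" and *: "M D (\<lambda>x. \<mu> x + a * \<nu> x) v" "M D (\<lambda>x. \<mu> x + b * \<nu> x) v"
    have "\<delta> l t (\<lambda>x. \<mu> x + a * \<nu> x) v - \<delta> l t (\<lambda>x. \<mu> x + b * \<nu> x) v = (a - b) * \<delta> l t \<nu> v" for l t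
      by (simp add: \<delta>_def algebra_simps)
    then have "(a - b) * \<delta> l t \<nu> v = 0" if "l ^ ?p ^ D = l" for l t
      using * that unfolding M_def by (metis diff_zero)
    then show "M D \<nu> v" using ab by (simp add: M_def)
  qed
  have "\<exists>D\<in>\<D>. \<forall>v\<in>UNIV. \<forall>\<mu>\<in>{\<mu>. functional scale \<mu>}. M D \<mu> v"
  proof (rule not_union_of_few_subspaces[OF fin\<D> card\<D>, where line = "\<lambda>v a w. v + scale a w"])
    have add: "\<delta> l t \<mu> (v + scale a w) = \<delta> l t \<mu> v + \<delta> l (t * a) \<mu> w" if "functional scale \<mu>" for l t \<mu> v a w
    proof -
      have \<mu>': "additive_map \<mu>" using that by (simp add: functional_def)
      show ?thesis
        by (simp add: \<delta>_def scale_right_distrib additive_map_add[OF \<rho>(1)] additive_map_add[OF \<mu>'] algebra_simps)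
    qed
    show "\<forall>\<mu>\<in>{\<mu>. functional scale \<mu>}. M D \<mu> v"
      if "\<forall>\<mu>\<in>{\<mu>. functional scale \<mu>}. M D \<mu> w" "\<forall>\<mu>\<in>{\<mu>. functional scale \<mu>}. M D \<mu> (v + scale a w)"
      for D v a w
    proof
      fix \<mu> assume \<mu>: "\<mu> \<in> {\<mu>. functional scale \<mu>}"
      have "\<delta> l t \<mu> v = 0" if l: "l ^ ?p ^ D = l" for l t
      proof -
        have "\<delta> l t \<mu> (v + scale a w) = 0" "\<delta> l (t * a) \<mu> w = 0"
          using \<mu> l \<open>\<forall>\<mu>\<in>{\<mu>. functional scale \<mu>}. M D \<mu> w\<close>
            \<open>\<forall>\<mu>\<in>{\<mu>. functional scale \<mu>}. M D \<mu> (v + scale a w)\<close> unfolding M_def by blast+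
        then show ?thesis using add[of \<mu> l t v a w] \<mu> by simp
      qed
      then show "M D \<mu> v" by (simp add: M_def)
    qed
    show "\<forall>\<mu>\<in>{\<mu>. functional scale \<mu>}. M D \<mu> w"
      if ab: "a \<noteq> b" and *: "\<forall>\<mu>\<in>{\<mu>. functional scale \<mu>}. M D \<mu> (v + scale a w)"
        "\<forall>\<mu>\<in>{\<mu>. functional scale \<mu>}. M D \<mu> (v + scale b w)" for D v a b w
    proof
      fix \<mu> assume \<mu>: "\<mu> \<in> {\<mu>. functional scale \<mu>}"
      then have \<mu>': "additive_map \<mu>" by (simp add: functional_def)
      have "\<delta> l t \<mu> w = 0" if l: "l ^ ?p ^ D = l" for l t
      proof -
        let ?t = "t / (a - b)"
        have "\<delta> l ?t \<mu> (v + scale a w) = 0" "\<delta> l ?t \<mu> (v + scale b w) = 0"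
          using \<mu> l * unfolding M_def by blast+
        then have "\<delta> l (?t * a) \<mu> w = \<delta> l (?t * b) \<mu> w" using add \<mu> by (metis mem_Collect_eq add_left_cancel)
        moreover have "\<delta> l (?t * a) \<mu> w = \<delta> l (?t * b) \<mu> w + \<delta> l (?t * a - ?t * b) \<mu> w"
          by (simp add: \<delta>_def right_diff_distrib scale_left_diff_distrib additive_map_diff[OF \<rho>(1)]
            additive_map_diff[OF \<mu>'])
        moreover have "?t * a - ?t * b = t"
          unfolding right_diff_distrib[symmetric] using ab by simp
        ultimately show ?thesis by simp
      qed
      then show "M D \<mu> w" by (simp add: M_def)
    qed
  qed (use all_\<mu> in auto)
  then obtain D where D: "D \<in> \<D>" and lin: "\<And>v \<mu>. functional scale \<mu> \<Longrightarrow> M D \<mu> v" by auto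
  have "\<rho> (scale l v) = scale l (\<rho> v)" if l: "l ^ ?p ^ D = l" for l v
  proof (rule ccontr)
    let ?z = "\<rho> (scale l v) - scale l (\<rho> v)"
    assume "\<rho> (scale l v) \<noteq> scale l (\<rho> v)"
    then have z: "?z \<notin> {0}" by simp
    have "subfield_set (UNIV :: 'a set)" "subspace_over UNIV scale {0}"
      by (auto simp: subfield_set_def subspace_over_def)
    from separating_functional[OF vs this(1) fin this(2) z] obtain \<mu> where
      \<mu>: "additive_map \<mu>" "\<And>k x. \<mu> (scale k x) = k * \<mu> x" "\<mu> ?z = 1" by auto
    then have "M D \<mu> v" by (intro lin) (simp add: functional_def)
    then have "\<delta> l 1 \<mu> v = 0" using l by (simp add: M_def)
    then have "\<mu> ?z = 0" by (simp add: \<delta>_def additive_map_diff[OF \<mu>(1)] \<mu>(2))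
    then show False using \<mu>(3) by simp
  qed
  then show ?thesis using D unfolding \<D>_def by blast
qed

section \<open>Splitting the space along an additive subgroup\<close>

lemma card_multiples_less:
  fixes scale :: "'a::{field,finite} \<Rightarrow> 'v::ab_group_add \<Rightarrow> 'v"
  assumes vs: "vector_space scale" and "0 \<in> U" "finite U"
  shows "card ((\<lambda>(a, u). scale a u) ` (UNIV \<times> U)) < CARD('a) * card U"
proof -
  interpret vector_space scale by fact
  let ?W = "(\<lambda>(a, u). scale a u) ` (UNIV \<times> U)" and ?A = "(UNIV - {0::'a}) \<times> (U - {0})"
  have Q: "CARD('a) > 1" by (rule one_less_CARD_field)
  have U0: "card U > 0" using assms by (auto simp: card_gt_0_iff)
  have "?W \<subseteq> insert 0 ((\<lambda>(a, u). scale a u) ` ?A)"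
  proof
    fix w assume "w \<in> ?W"
    then obtain a u where "w = scale a u" "u \<in> U" by auto
    then show "w \<in> insert 0 ((\<lambda>(a, u). scale a u) ` ?A)" by (cases "a = 0 \<or> u = 0") auto
  qed
  then have "card ?W \<le> card (insert 0 ((\<lambda>(a, u). scale a u) ` ?A))"
    using assms by (intro card_mono) auto
  also have "\<dots> \<le> Suc (card ((\<lambda>(a, u). scale a u) ` ?A))" by (rule card_insert_le_m1) simp_all
  also have "\<dots> \<le> Suc (card ?A)" using card_image_le[of ?A] assms by simp
  also have "card ?A = (CARD('a) - 1) * (card U - 1)"
    using assms by (simp add: card_cartesian_product card_Diff_singleton)
  also have "Suc ((CARD('a) - 1) * (card U - 1)) < CARD('a) * card U"
  proof -
    obtain x y where "CARD('a) = Suc (Suc x)" "card U = Suc y"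
      using Q U0 by (metis Suc_lessE One_nat_def gr0_implies_Suc)
    then show ?thesis by simp
  qed
  finally show ?thesis .
qed

text \<open>
  Take an \<open>F\<close>-subspace \<open>C\<close> maximal with \<open>U \<inter> C = {0}\<close>. The vectors \<open>v\<close> for which \<open>C + F v\<close>
  meets \<open>U\<close> outside zero are of the form \<open>a u + x\<close> with \<open>u\<close> in \<open>U\<close> and \<open>x\<close> in \<open>C\<close>; there are fewer
  than \<open>Q |U| |C|\<close> of these. If \<open>|U| |C| < |V|\<close>, then \<open>Q |U| |C| \<le> |V|\<close>, because all orders are
  powers of \<open>Q\<close>, and \<open>C\<close> can be enlarged.
\<close>

lemma exists_complement:
  fixes scale :: "'a::{field,finite} \<Rightarrow> 'v::ab_group_add \<Rightarrow> 'v"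
  assumes vs: "vector_space scale" and fin: "finite (UNIV :: 'v set)"
    and U: "subspace_over prime_subfield scale U"
    and cU: "card U = CARD('a) ^ k" and cV: "CARD('v) = CARD('a) ^ r"
  shows "\<exists>C. subspace_over UNIV scale C \<and> U \<inter> C = {0} \<and> card U * card C = CARD('v)"
proof -
  interpret vector_space scale by fact
  have LU: "subfield_set (UNIV :: 'a set)" by (auto simp: subfield_set_def)
  have finS: "finite S" for S :: "'v set" using fin by (rule rev_finite_subset) simp
  have U0: "0 \<in> U" using U by (simp add: subspace_over_def)
  define F where "F = {C. subspace_over UNIV scale C \<and> U \<inter> C = {0}}"
  have "{0} \<in> F" using U0 by (auto simp: F_def subspace_over_def)
  moreover have "finite F"
    using fin[THEN finite_Pow_iff[THEN iffD2]] by (rule rev_finite_subset) simp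
  ultimately obtain C where C: "C \<in> F" and max: "\<And>C'. C' \<in> F \<Longrightarrow> C \<subseteq> C' \<Longrightarrow> C = C'"
    using finite_has_maximal2 by metis
  have CS: "subspace_over UNIV scale C" and UC: "U \<inter> C = {0}" using C by (auto simp: F_def)
  obtain c where c: "card C = CARD('a) ^ c"
    using card_subspace_over_power[OF vs LU CS finS] by auto
  have Q: "CARD('a) > 1" by (rule one_less_CARD_field)
  have inj: "inj_on (\<lambda>(u, c). u + c) (U \<times> C)"
  proof -
    have "u = u' \<and> x = x'" if "u \<in> U" "u' \<in> U" "x \<in> C" "x' \<in> C" "u + x = u' + x'" for u u' x x'
    proof -
      have "u - u' = x' - x" using that(5) by (metis add_diff_cancel_right add_diff_cancel_left add.commute diff_diff_eq2)
      moreover have "u - u' \<in> U" "x' - x \<in> C"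
        using that subspace_over_diff[OF vs subfield_prime_subfield U] subspace_over_diff[OF vs LU CS] by auto
      ultimately have "u - u' \<in> U \<inter> C" by simp
      then show ?thesis using that(5) unfolding UC by simp
    qed
    then show ?thesis by (auto simp: inj_on_def)
  qed
  have le: "card U * card C \<le> CARD('v)"
    using card_inj_on_le[OF inj _ fin] by (simp add: card_cartesian_product)
  have "CARD('v) \<le> card U * card C"
  proof (rule ccontr)
    assume "\<not> CARD('v) \<le> card U * card C"
    then have "CARD('a) ^ (k + c) < CARD('a) ^ r" by (simp add: cU c cV power_add)
    then have "Suc (k + c) \<le> r" using Q by (simp add: Suc_le_eq)
    then have big: "CARD('a) * card U * card C \<le> CARD('v)"
      using Q power_increasing[of "Suc (k + c)" r "CARD('a)"] by (simp add: cU c cV power_add mult_ac)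
    let ?W = "(\<lambda>(a, u). scale a u) ` (UNIV \<times> U)"
    let ?bad = "(\<lambda>(w, x). w + x) ` (?W \<times> C)"
    have "card ?bad \<le> card ?W * card C"
      using card_image_le[of "?W \<times> C" "\<lambda>(w, x). w + x"] finS by (simp add: card_cartesian_product)
    also have "\<dots> < CARD('a) * card U * card C"
      using card_multiples_less[OF vs U0 finS] c Q by simp
    finally have "?bad \<noteq> UNIV" using big by auto
    then obtain v where v: "v \<notin> ?bad" by blast
    have nv: "v \<noteq> scale a u + x" if "u \<in> U" "x \<in> C" for a u x
      using v that by force
    have "U \<inter> adjoin UNIV scale C v = {0}"
    proof (intro equalityI subsetI)
      fix u assume u: "u \<in> U \<inter> adjoin UNIV scale C v"
      then obtain x a where x: "x \<in> C" "u = x + scale a v" by (auto simp: adjoin_def)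
      show "u \<in> {0}"
      proof (cases "a = 0")
        case True
        then have "u \<in> U \<inter> C" using u x by simp
        then show ?thesis unfolding UC .
      next
        case False
        then have "v = scale (inverse a) (scale a v)" by simp
        also have "scale a v = u - x" using x by simp
        finally have "v = scale (inverse a) u + scale (- inverse a) x"
          by (simp add: scale_right_diff_distrib)
        moreover have "scale (- inverse a) x \<in> C" using CS x(1) unfolding subspace_over_def by blast
        ultimately show ?thesis using nv u by blast
      qed
    qed (use U0 adjoin_superset(1)[OF vs LU CS, of v] CS in \<open>auto simp: subspace_over_def\<close>)
    then have "adjoin UNIV scale C v \<in> F" using subspace_over_adjoin[OF vs LU CS] by (simp add: F_def)
    then have "v \<in> C" using max adjoin_superset[OF vs LU CS, of v] by blast
    then show False using nv[OF U0, of v 0] by simp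
  qed
  then show ?thesis using le CS UC by (intro exI[of _ C]) simp
qed

lemma exists_projection:
  fixes U C :: "'v::ab_group_add set"
  assumes fin: "finite (UNIV :: 'v set)"
    and U: "0 \<in> U" "\<And>x y. x \<in> U \<Longrightarrow> y \<in> U \<Longrightarrow> x + y \<in> U" "\<And>x y. x \<in> U \<Longrightarrow> y \<in> U \<Longrightarrow> x - y \<in> U"
    and C: "0 \<in> C" "\<And>x y. x \<in> C \<Longrightarrow> y \<in> C \<Longrightarrow> x + y \<in> C" "\<And>x y. x \<in> C \<Longrightarrow> y \<in> C \<Longrightarrow> x - y \<in> C"
    and UC: "U \<inter> C = {0}" and card: "card U * card C = CARD('v)"
  shows "\<exists>\<rho>. additive_map \<rho> \<and> (\<forall>v. \<rho> v \<in> C) \<and> (\<forall>v. v - \<rho> v \<in> U) \<and> (\<forall>u\<in>U. \<rho> u = 0) \<and> (\<forall>c\<in>C. \<rho> c = c)"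
proof -
  have uniq: "x = x'" if "u - x \<in> U" "u - x' \<in> U" "x \<in> C" "x' \<in> C" for u x x'
  proof -
    have "(u - x') - (u - x) \<in> U" using that U(3) by blast
    then have "x - x' \<in> U \<inter> C" using that C(3) by simp
    then show ?thesis unfolding UC by simp
  qed
  have inj: "inj_on (\<lambda>(u, c). u + c) (U \<times> C)"
  proof -
    have "u = u' \<and> x = x'" if *: "u \<in> U" "u' \<in> U" "x \<in> C" "x' \<in> C" "u + x = u' + x'" for u u' x x'
    proof -
      have "(u + x) - x \<in> U" using *(1) by simp
      moreover have "(u + x) - x' \<in> U" using *(2) unfolding *(5) by simp
      ultimately have "x = x'" using *(3,4) by (rule uniq)
      then show ?thesis using *(5) by simp
    qed
    then show ?thesis by (auto simp: inj_on_def)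
  qed
  have "(\<lambda>(u, c). u + c) ` (U \<times> C) = UNIV"
    using card_image[OF inj] card by (intro card_subset_eq[OF fin]) (simp_all add: card_cartesian_product)
  then have ex: "\<exists>x\<in>C. v - x \<in> U" for v
  proof -
    have "v \<in> (\<lambda>(u, c). u + c) ` (U \<times> C)"
      using \<open>(\<lambda>(u, c). u + c) ` (U \<times> C) = UNIV\<close> by simp
    then show ?thesis by force
  qed
  then obtain \<rho> where \<rho>: "\<And>v. \<rho> v \<in> C" "\<And>v. v - \<rho> v \<in> U" by metis
  have "\<rho> (x + y) = \<rho> x + \<rho> y" for x y
  proof (rule uniq[of "x + y"])
    have "(x - \<rho> x) + (y - \<rho> y) \<in> U" using U(2) \<rho>(2) by blast
    then show "x + y - (\<rho> x + \<rho> y) \<in> U" by (simp add: algebra_simps)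
  qed (use \<rho> C in auto)
  moreover have "\<rho> u = 0" if "u \<in> U" for u
    by (rule uniq[of u]) (use \<rho> C that in auto)
  moreover have "\<rho> c = c" if "c \<in> C" for c
    by (rule uniq[of c]) (use \<rho> U that in auto)
  ultimately show ?thesis using \<rho> unfolding additive_map_def by blast
qed

text \<open>
  With \<open>\<sigma> x = x ^ (p ^ D)\<close> and \<open>N = D M\<close>, the map \<open>1 + \<sigma> + \<dots> + \<sigma> ^ (M - 1)\<close> annihilates the image
  of \<open>\<sigma> - 1\<close>. It is a polynomial of degree \<open>p ^ (N - D)\<close>, which bounds that image; the kernel of
  \<open>\<sigma> - 1\<close> is thus large.
\<close>

lemma card_fixed_frobenius:
  assumes N: "CARD('a::{field,finite}) = CHAR('a) ^ N" and D: "D > 0" "D dvd N"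
  shows "CHAR('a) ^ D \<le> card {l :: 'a. l ^ CHAR('a) ^ D = l}"
proof -
  let ?p = "CHAR('a)"
  obtain M where M: "N = D * M" using D(2) by auto
  have "CARD('a) > 1" by (rule one_less_CARD_field)
  then have M0: "M > 0" using N M by (cases M) auto
  have p: "?p > 1" by (rule prime_gt_1_nat[OF prime_CHAR_finite])
  have frob: "additive_map (\<lambda>x::'a. x ^ ?p ^ i)" for i
    by (simp add: additive_map_def freshmans_dream'[OF prime_CHAR_finite refl])
  define g where "g x = x ^ ?p ^ D - x" for x :: 'a
  have g: "additive_map g"
    by (simp add: additive_map_def g_def additive_map_add[OF frob])
  define T :: "'a poly" where "T = (\<Sum>i<M. monom 1 (?p ^ (D * i)))"
  have "poly T (g x) = 0" for x
  proof -
    have "poly T (g x) = (\<Sum>i<M. x ^ ?p ^ (D * Suc i) - x ^ ?p ^ (D * i))"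
      unfolding T_def poly_sum poly_monom
    proof (rule sum.cong)
      fix i
      have "g x ^ ?p ^ (D * i) = (x ^ ?p ^ D) ^ ?p ^ (D * i) - x ^ ?p ^ (D * i)"
        unfolding g_def by (rule additive_map_diff[OF frob])
      also have "(x ^ ?p ^ D) ^ ?p ^ (D * i) = x ^ ?p ^ (D * Suc i)"
        by (simp only: mult_Suc_right power_add power_mult)
      finally show "1 * g x ^ ?p ^ (D * i) = x ^ ?p ^ (D * Suc i) - x ^ ?p ^ (D * i)" by simp
    qed simp
    also have "\<dots> = x ^ ?p ^ (D * M) - x ^ ?p ^ (D * 0)" by (rule sum_lessThan_telescope)
    also have "\<dots> = 0" using finite_field_power_CARD[of x] by (simp add: M[symmetric] N)
    finally show ?thesis .
  qed
  then have "range g \<subseteq> {x. poly T x = 0}" by auto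
  then have "card (range g) \<le> card {x. poly T x = 0}" by (intro card_mono) auto
  also have "\<dots> \<le> degree T"
  proof (rule card_poly_roots_bound)
    have "coeff T (?p ^ (D * 0)) = (\<Sum>i<M. if i = 0 then 1 else 0)"
      unfolding T_def coeff_sum coeff_monom using p D by (intro sum.cong) (auto simp: power_inject_exp)
    then have "coeff T 1 = 1" using M0 by simp
    then show "T \<noteq> 0" by auto
  qed
  also have "degree T \<le> ?p ^ (D * (M - 1))" unfolding T_def
  proof (rule degree_sum_le)
    fix i assume "i \<in> {..<M}"
    then have "?p ^ (D * i) \<le> ?p ^ (D * (M - 1))" using p by (intro power_increasing mult_le_mono) auto
    then show "degree (monom (1::'a) (?p ^ (D * i))) \<le> ?p ^ (D * (M - 1))"
      using degree_monom_le[of "1::'a" "?p ^ (D * i)"] by linarith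
  qed simp
  finally have "card (range g) \<le> ?p ^ (D * (M - 1))" .
  then have "?p ^ N \<le> ?p ^ (D * (M - 1)) * card {x. g x = 0}"
    using card_range_ker[OF g] by (metis N mult_le_mono1)
  moreover have "?p ^ N = ?p ^ (D * (M - 1)) * ?p ^ D"
    unfolding M using M0 by (cases M) (simp_all add: power_add)
  ultimately have "?p ^ D \<le> card {x. g x = 0}" using p by simp
  then show ?thesis by (simp add: g_def)
qed

theorem linear_over_large_subfield:
  fixes scale :: "'a::{field,finite} \<Rightarrow> 'v::ab_group_add \<Rightarrow> 'v"
  assumes vs: "vector_space scale" and fin: "finite (UNIV :: 'v set)"
    and U: "subspace_over prime_subfield scale U"
    and cU: "card U = CARD('a) ^ k" and cV: "CARD('v) = CARD('a) ^ r"
    and s: "s \<le> CARD('a)"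
    and hyp: "\<And>\<mu>. functional scale \<mu> \<Longrightarrow> \<mu> ` U \<noteq> UNIV \<Longrightarrow> card (\<mu> ` U) * s \<le> CARD('a)"
  shows "s \<le> card {l. \<forall>u\<in>U. scale l u \<in> U}"
proof -
  interpret vector_space scale by fact
  obtain N where N: "CARD('a) = CHAR('a) ^ N" using CARD_eq_CHAR_power by blast
  have U': "0 \<in> U" "\<And>x y. x \<in> U \<Longrightarrow> y \<in> U \<Longrightarrow> x + y \<in> U" "\<And>x y. x \<in> U \<Longrightarrow> y \<in> U \<Longrightarrow> x - y \<in> U"
    using U subspace_over_diff[OF vs subfield_prime_subfield U] by (auto simp: subspace_over_def)
  obtain C where C: "subspace_over UNIV scale C" "U \<inter> C = {0}" "card U * card C = CARD('v)"
    using exists_complement[OF vs fin U cU cV] by blast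
  have LU: "subfield_set (UNIV :: 'a set)" by (auto simp: subfield_set_def)
  have C': "0 \<in> C" "\<And>x y. x \<in> C \<Longrightarrow> y \<in> C \<Longrightarrow> x + y \<in> C" "\<And>x y. x \<in> C \<Longrightarrow> y \<in> C \<Longrightarrow> x - y \<in> C"
    "\<And>t c. c \<in> C \<Longrightarrow> scale t c \<in> C"
    using C(1) subspace_over_diff[OF vs LU C(1)] by (auto simp: subspace_over_def)
  from exists_projection[OF fin U' C'(1-3) C(2,3)] obtain \<rho> where
    \<rho>: "additive_map \<rho>" "\<And>v. \<rho> v \<in> C" "\<And>v. v - \<rho> v \<in> U" "\<And>u. u \<in> U \<Longrightarrow> \<rho> u = 0" "\<And>c. c \<in> C \<Longrightarrow> \<rho> c = c"
    by blast
  from uniform_semilinear[OF vs fin N U'(1,3) C'(4) \<rho> s hyp] obtain D where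
    D: "D > 0" "D dvd N" "s \<le> CHAR('a) ^ D" and
    lin: "\<And>l v. l ^ CHAR('a) ^ D = l \<Longrightarrow> \<rho> (scale l v) = scale l (\<rho> v)" by blast
  have "scale l u \<in> U" if "l ^ CHAR('a) ^ D = l" "u \<in> U" for l u
    using \<rho>(3)[of "scale l u"] lin[OF that(1), of u] \<rho>(4)[OF that(2)] by simp
  then have "{l. l ^ CHAR('a) ^ D = l} \<subseteq> {l. \<forall>u\<in>U. scale l u \<in> U}" by blast
  then have "card {l :: 'a. l ^ CHAR('a) ^ D = l} \<le> card {l. \<forall>u\<in>U. scale l u \<in> U}"
    by (rule card_mono[OF finite])
  then show ?thesis using D(3) card_fixed_frobenius[OF N D(1,2)] by linarith
qed

section \<open>Dimensions and hyperplanes\<close>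

lemma (in vector_space) card_span_independent:
  assumes "finite (UNIV :: 'a set)" "finite B" "independent B"
  shows "finite (span B) \<and> card (span B) = CARD('a) ^ card B"
  using assms(2,3)
proof (induction B rule: finite_induct)
  case empty
  then show ?case by simp
next
  case (insert b B)
  have vs: "vector_space scale" by unfold_locales
  have L: "subfield_set (UNIV :: 'a set)" by (auto simp: subfield_set_def)
  have sub: "subspace_over UNIV scale (span B)"
    by (simp add: subspace_over_def span_zero span_add span_scale)
  have IH: "finite (span B)" "card (span B) = CARD('a) ^ card B" and b: "b \<notin> span B"
    using insert independent_insert[of b B] by auto
  have "span (insert b B) = adjoin UNIV scale (span B) b"
  proof (intro equalityI subsetI)
    fix x assume "x \<in> span (insert b B)"
    then obtain k where "x - scale k b \<in> span B" unfolding span_insert by blast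
    then have "(x - scale k b, k) \<in> span B \<times> UNIV" by simp
    then show "x \<in> adjoin UNIV scale (span B) b"
      unfolding adjoin_def by (rule rev_image_eqI) simp
  next
    fix x assume "x \<in> adjoin UNIV scale (span B) b"
    then obtain y k where "y \<in> span B" "x = y + scale k b" by (auto simp: adjoin_def)
    then have "x - scale k b \<in> span B" by simp
    then show "x \<in> span (insert b B)" unfolding span_insert by blast
  qed
  moreover have "finite (adjoin UNIV scale (span B) b)"
    unfolding adjoin_def using IH(1) assms(1) by simp
  ultimately show ?case using card_adjoin[OF vs L sub b] IH(2) insert.hyps by simp
qed

text \<open>
  The dimension of an infinite-dimensional space is \<open>0\<close> by convention, so a positive dimension
  already implies finiteness.
\<close>

lemma (in vector_space) card_subspace:
  assumes "finite (UNIV :: 'a set)" "subspace S" "finite S \<or> dim S > 0"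
  shows "finite S \<and> card S = CARD('a) ^ dim S"
proof -
  obtain B where B: "B \<subseteq> S" "independent B" "S \<subseteq> span B" "card B = dim S" by (rule basis_exists)
  have "finite B" using assms(3) B(1,4) by (metis finite_subset card.infinite less_irrefl)
  moreover have "span B = S" using B assms(2) span_minimal by blast
  ultimately show ?thesis using card_span_independent[OF assms(1) _ B(2)] B(4) by simp
qed

lemma vector_space_restrict_scalars:
  fixes scale :: "'a::field \<Rightarrow> 'v::ab_group_add \<Rightarrow> 'v" and h :: "'k::field \<Rightarrow> 'a"
  assumes vs: "vector_space scale"
    and h: "h \<in> ring_hom ring_of_type_algebra ring_of_type_algebra"
  shows "vector_space (restrict_scalars h scale)"
proof -
  interpret vector_space scale by fact
  have "h (x + y) = h x + h y" "h (x * y) = h x * h y" "h 1 = 1" for x y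
    using h by (auto simp: ring_hom_def ring_of_type_algebra_def)
  then show ?thesis by unfold_locales (simp_all add: restrict_scalars_def algebra_simps)
qed

lemma subfield_of_subfield_set:
  assumes "subfield_set (L :: 'a::field set)"
  shows "subfield L ring_of_type_algebra"
proof -
  interpret R: field "ring_of_type_algebra :: 'a ring" by (rule field_from_type_algebra)
  have c: "carrier (ring_of_type_algebra :: 'a ring) = UNIV" by (simp add: ring_of_type_algebra_def)
  show ?thesis
  proof (rule R.subfieldI')
    show "subring L ring_of_type_algebra"
    proof (rule R.subringI)
      fix x assume "x \<in> L"
      have "\<ominus>\<^bsub>ring_of_type_algebra\<^esub> x = - x"
        by (rule R.minus_equality) (auto simp: ring_of_type_algebra_def)
      then show "\<ominus>\<^bsub>ring_of_type_algebra\<^esub> x \<in> L" using assms \<open>x \<in> L\<close> by (simp add: subfield_set_def)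
    qed (use assms in \<open>auto simp: subfield_set_def ring_of_type_algebra_def\<close>)
    fix k assume "k \<in> L - {\<zero>\<^bsub>ring_of_type_algebra\<^esub>}"
    then have k: "k \<in> L" "k \<noteq> 0" by (auto simp: ring_of_type_algebra_def)
    have "inv\<^bsub>ring_of_type_algebra\<^esub> k = inverse k"
      by (rule R.comm_inv_char) (use k in \<open>auto simp: ring_of_type_algebra_def\<close>)
    then show "inv\<^bsub>ring_of_type_algebra\<^esub> k \<in> L" using assms k by (simp add: subfield_set_def)
  qed
qed

text \<open>
  A nonzero functional is onto, so its kernel has order \<open>|V| / Q\<close>, and orders determine dimensions.
\<close>

lemma hyperplane_ker_functional:
  fixes scale :: "'a::{field,finite} \<Rightarrow> 'v::ab_group_add \<Rightarrow> 'v"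
  assumes vs: "vector_space scale" and fin: "finite (UNIV :: 'v set)"
    and \<mu>: "functional scale \<mu>" "\<mu> z \<noteq> 0"
  shows "hyperplane scale {v. \<mu> v = 0}"
proof -
  interpret vector_space scale by fact
  have \<mu>': "additive_map \<mu>" "\<And>c x. \<mu> (scale c x) = c * \<mu> x" using \<mu> by (auto simp: functional_def)
  let ?H = "{v. \<mu> v = 0}"
  have Q: "CARD('a) > 1" by (rule one_less_CARD_field)
  have sub: "subspace ?H"
    by (rule subspaceI) (simp_all add: additive_map_0[OF \<mu>'(1)] additive_map_add[OF \<mu>'(1)] \<mu>'(2))
  have "range \<mu> = UNIV"
  proof (intro equalityI subsetI)
    fix y
    have "y = \<mu> (scale (y / \<mu> z) z)" using \<mu>(2) by (simp add: \<mu>'(2))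
    then show "y \<in> range \<mu>" by (rule range_eqI)
  qed simp
  then have "CARD('a) * card ?H = CARD('v)"
    using card_image_ker[OF \<mu>'(1) fin] by simp
  moreover have "card ?H = CARD('a) ^ dim ?H"
    using card_subspace[OF finite sub] fin by (meson finite_subset subset_UNIV)
  moreover have "CARD('v) = CARD('a) ^ dim UNIV"
    using card_subspace[OF finite subspace_UNIV] fin by blast
  ultimately have "CARD('a) ^ Suc (dim ?H) = CARD('a) ^ dim UNIV" by simp
  then have "Suc (dim ?H) = dim UNIV" using Q by (simp only: power_inject_exp)
  then show ?thesis using sub by (simp add: hyperplane_def)
qed

theorem theorem7:
  fixes scale :: "'a::{field,finite} \<Rightarrow> 'v::ab_group_add \<Rightarrow> 'v"
    and h :: "'k::{field,finite} \<Rightarrow> 'a"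
    and U :: "'v set"
    and q n r m d :: nat
  assumes "primepow q" and "n \<ge> 1" and "r \<ge> 2"
    and "CARD('k) = q" and "CARD('a) = q ^ n"
    and "h \<in> ring_hom ring_of_type_algebra ring_of_type_algebra"
    and "vector_space scale" and "vector_space.dim scale UNIV = r"
    and "module.subspace (restrict_scalars h scale) U"
    and "vector_space.dim (restrict_scalars h scale) U = m"
    and "n dvd m" and "1 \<le> m" and "m \<le> (r - 1) * n"
    and "\<not> (\<exists>H. hyperplane scale H \<and>
               vector_space.dim (restrict_scalars h scale) (U \<inter> H) = m - n + 1)"
    and "m - n + d =
           Min {vector_space.dim (restrict_scalars h scale) (U \<inter> H) | H.
                  hyperplane scale H \<and>
                  vector_space.dim (restrict_scalars h scale) (U \<inter> H) > m - n}"
  shows "d dvd n \<and>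
         (\<exists>L :: 'a set. subfield L ring_of_type_algebra \<and> card L = q ^ d \<and>
            subspace_over L scale U)"
proof -
  note vs = \<open>vector_space scale\<close>
  interpret V: vector_space scale by fact
  have vk: "vector_space (restrict_scalars h scale)"
    by (rule vector_space_restrict_scalars[OF vs assms(6)])
  interpret K: vector_space "restrict_scalars h scale" by (rule vk)
  have h: "h (x + y) = h x + h y" "h (x * y) = h x * h y" "h 1 = 1" for x y
    using assms(6) by (auto simp: ring_hom_def ring_of_type_algebra_def)
  have q: "q > 1" using one_less_CARD_field[where ?'a = 'k] assms(4) by simp
  have Q: "CARD('a) = q ^ n" by fact
  obtain k where k: "m = n * k" using \<open>n dvd m\<close> by auto
  then have k0: "k > 0" using \<open>1 \<le> m\<close> by (cases k) auto
  then have nm: "n \<le> m" using k by simp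
  have mrn: "m < r * n" using assms(2,3,13) by (cases r) auto

  have fin: "finite (UNIV :: 'v set)" and cV: "CARD('v) = CARD('a) ^ r"
    using V.card_subspace[OF finite V.subspace_UNIV] assms(3,8) by auto
  have finS: "finite S" for S :: "'v set" using fin by (rule rev_finite_subset) simp
  have cK: "card S = q ^ K.dim S" if "K.subspace S" for S
    using K.card_subspace[OF finite that] finS assms(4) by simp
  have subU: "K.subspace U" by fact
  have cU: "card U = q ^ m" using cK[OF subU] assms(10) by simp
  then have cUk: "card U = CARD('a) ^ k" by (simp add: Q k power_mult)
  have U': "0 \<in> U" "\<And>x y. x \<in> U \<Longrightarrow> y \<in> U \<Longrightarrow> x + y \<in> U" "\<And>x y. x \<in> U \<Longrightarrow> y \<in> U \<Longrightarrow> x - y \<in> U"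
    using subU by (auto intro: K.subspace_0 K.subspace_add K.subspace_diff)
  have scaleU: "scale (h c) x \<in> U" if "x \<in> U" for c x
    using K.subspace_scale[OF subU that, of c] by (simp add: restrict_scalars_def)
  have primeU: "subspace_over prime_subfield scale U"
    using vs U'(1,2) by (rule subspace_over_prime_subfield_scale)

  have hypsub: "K.subspace H" if "hyperplane scale H" for H
  proof -
    have "V.subspace H" using that by (simp add: hyperplane_def)
    then show ?thesis
      by (intro K.subspaceI) (auto simp: restrict_scalars_def intro: V.subspace_0 V.subspace_add V.subspace_scale)
  qed
  have cUH: "card (U \<inter> H) = q ^ K.dim (U \<inter> H)" if "hyperplane scale H" for H
    using cK K.subspace_inter[OF subU hypsub[OF that]] by blast

  let ?w = "\<lambda>H. K.dim (U \<inter> H)"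
  define W where "W = {?w H | H. hyperplane scale H \<and> ?w H > m - n}"
  have finW: "finite W"
  proof -
    have "W \<subseteq> ?w ` Pow UNIV" by (auto simp: W_def)
    then show ?thesis using fin by (meson finite_Pow_iff finite_imageI finite_subset)
  qed
  have min: "m - n + d = Min W" unfolding W_def by fact

  have ker: "\<exists>H. hyperplane scale H \<and> card (\<mu> ` U) * q ^ ?w H = q ^ m \<and> ?w H > m - n"
    if \<mu>: "functional scale \<mu>" "\<mu> ` U \<noteq> UNIV" "\<mu> z \<noteq> 0" for \<mu> z
  proof -
    let ?H = "{v. \<mu> v = 0}"
    have H: "hyperplane scale ?H" by (rule hyperplane_ker_functional[OF vs fin \<mu>(1,3)])
    have "additive_map \<mu>" using \<mu>(1) by (simp add: functional_def)
    from card_image_ker[OF this finS U'(2,3)]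
    have "card (\<mu> ` U) * card (U \<inter> ?H) = q ^ m" by (simp add: cU Int_def)
    then have eq: "card (\<mu> ` U) * q ^ ?w ?H = q ^ m" unfolding cUH[OF H] .
    have "card (\<mu> ` U) < q ^ n"
      using psubset_card_mono[of UNIV "\<mu> ` U"] \<mu>(2) by (simp add: Q psubset_eq)
    then have "card (\<mu> ` U) * q ^ ?w ?H < q ^ n * q ^ ?w ?H"
      by (rule mult_strict_right_mono) (use q in simp)
    then have "q ^ m < q ^ (n + ?w ?H)" unfolding eq power_add .
    then have "m < n + ?w ?H" by (rule power_less_imp_less_exp[OF q])
    then have "?w ?H > m - n" using nm by linarith
    then show ?thesis using H eq by blast
  qed

  (* A functional that does not map U onto F exists because U is a proper subset of V: extend
     an additive map into the prime field that kills U, and write it as a trace. *)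
  have "W \<noteq> {}"
  proof -
    have "q ^ m < q ^ (n * r)" using mrn q by (simp add: mult.commute)
    then have "card U < CARD('v)" by (simp only: cU cV Q power_mult)
    then obtain z where z: "z \<notin> U" by (metis UNIV_eq_I less_irrefl)
    from separating_functional[OF vs subfield_prime_subfield fin primeU z] obtain \<psi> where
      \<psi>: "additive_map \<psi>" "range \<psi> \<subseteq> (prime_subfield :: 'a set)" "\<forall>x\<in>U. \<psi> x = 0" "\<psi> z = 1" by blast
    obtain N where N: "CARD('a) = CHAR('a) ^ N" using CARD_eq_CHAR_power by blast
    have "\<psi> x ^ CHAR('a) = \<psi> x" for x using \<psi>(2) by (intro prime_subfield_power) auto
    from frob_trace_lift[OF vs N \<psi>(1) this] obtain \<mu> where
      \<mu>: "functional scale \<mu>" "\<And>x. \<psi> x = frob_trace N (\<mu> x)" by blast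
    have "\<mu> z \<noteq> 0"
      using \<mu>(2)[of z] \<psi>(4) by (auto simp: additive_map_0[OF additive_map_frob_trace])
    moreover have "\<mu> z \<notin> \<mu> ` U" using \<mu>(2) \<psi>(3,4) by (metis imageE zero_neq_one)
    ultimately show ?thesis using ker[OF \<mu>(1), of z] by (auto simp: W_def)
  qed
  then have "m - n + d \<in> W" unfolding min using finW by (rule Min_in[rotated])
  then obtain H0 where H0: "hyperplane scale H0" "?w H0 = m - n + d" "?w H0 > m - n"
    by (auto simp: W_def)
  have d0: "d > 0" using H0 by simp
  have "q ^ ?w H0 \<le> q ^ m" unfolding cUH[OF H0(1), symmetric] cU[symmetric]
    by (rule card_mono[OF finS]) simp
  then have dn: "d \<le> n" using q nm H0(2) by simp

  define L where "L = {l. \<forall>u\<in>U. scale l u \<in> U}"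
  have "q ^ d \<le> card L" unfolding L_def
  proof (rule linear_over_large_subfield[OF vs fin primeU cUk cV])
    show "q ^ d \<le> CARD('a)" using dn q by (simp add: Q)
    fix \<mu> assume \<mu>: "functional scale \<mu>" "\<mu> ` U \<noteq> UNIV"
    show "card (\<mu> ` U) * q ^ d \<le> CARD('a)"
    proof (cases "\<exists>z. \<mu> z \<noteq> 0")
      case True
      then obtain H where H: "hyperplane scale H" "card (\<mu> ` U) * q ^ ?w H = q ^ m" "?w H > m - n"
        using ker[OF \<mu>] by blast
      then have "m - n + d \<le> ?w H" unfolding min using finW by (intro Min_le) (auto simp: W_def)
      then have "card (\<mu> ` U) * q ^ (m - n + d) \<le> q ^ m"
        using q unfolding H(2)[symmetric] by (intro mult_le_mono power_increasing) auto
      also have "q ^ m = q ^ (m - n) * q ^ n" using nm by (simp flip: power_add)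
      finally have "q ^ (m - n) * (card (\<mu> ` U) * q ^ d) \<le> q ^ (m - n) * q ^ n"
        by (simp add: power_add mult_ac)
      then show ?thesis using q by (simp add: Q)
    next
      case False
      then have "\<mu> ` U = {0}" using U'(1) by auto
      then show ?thesis using dn q by (simp add: Q)
    qed
  qed
  have L: "subfield_set L"
    by (rule subfield_setI_finite) (use U' in \<open>auto simp: L_def V.scale_left_distrib simp flip: V.scale_scale\<close>)
  have h0: "h x = 0 \<Longrightarrow> x = 0" for x
    using h(2)[of x "inverse x"] h(3) by (cases "x = 0") auto
  have injh: "inj h"
  proof (rule injI)
    fix x y assume "h x = h y"
    then have "h (x - y) = 0" using h(1)[of "x - y" y] by simp
    then show "x = y" using h0[of "x - y"] by simp
  qed
  have F: "subfield_set (range h)"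
  proof (rule subfield_setI_finite)
    have "h 0 = h 0 + h 0" using h(1)[of 0 0] by (simp only: add_0_right)
    then have "h 0 = 0" by (metis add_cancel_right_right)
    then show "0 \<in> range h" by (metis rangeI)
    show "1 \<in> range h" using h(3) by (metis rangeI)
    show "x + y \<in> range h" if "x \<in> range h" "y \<in> range h" for x y
      using that h(1) by (metis (no_types, lifting) imageE rangeI)
    show "x * y \<in> range h" if "x \<in> range h" "y \<in> range h" for x y
      using that h(2) by (metis (no_types, lifting) imageE rangeI)
  qed
  have "subspace_over (range h) (*) L"
    using L scaleU by (auto simp: subspace_over_def subfield_set_def L_def simp flip: V.scale_scale)
  then obtain e where e: "card L = q ^ e"
    using card_subspace_over_power[OF vector_space_field F] card_image[OF injh] assms(4) by auto
  have "d \<le> e" using \<open>q ^ d \<le> card L\<close> q by (simp add: e)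
  have dvd: "e dvd a" if "q ^ a = card L ^ j" for a j
  proof -
    have "q ^ a = q ^ (e * j)" using that by (simp add: e power_mult)
    then show ?thesis using q by (simp only: power_inject_exp dvd_triv_left)
  qed
  have subLU: "subspace_over L scale U" using U' by (auto simp: subspace_over_def L_def)
  have "e dvd m" using card_subspace_over_power[OF vs L subLU finS] dvd cU by metis
  moreover have "e dvd n"
  proof -
    have "subspace_over L (*) UNIV" by (simp add: subspace_over_def)
    then show ?thesis using card_subspace_over_power[OF vector_space_field L] dvd Q by (metis finite)
  qed
  moreover have "e dvd m - n + d"
  proof -
    have "V.subspace H0" using H0(1) by (simp add: hyperplane_def)
    then have "subspace_over L scale (U \<inter> H0)"
      using subLU by (auto simp: subspace_over_def intro: V.subspace_0 V.subspace_add V.subspace_scale)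
    then show ?thesis using card_subspace_over_power[OF vs L _ finS] dvd cUH[OF H0(1)] H0(2) by metis
  qed
  ultimately have "e dvd d" by (metis dvd_diff_nat dvd_add_right_iff)
  then have "e = d" using d0 \<open>d \<le> e\<close> by (simp add: dvd_imp_le le_antisym)
  then show ?thesis using \<open>e dvd n\<close> subfield_of_subfield_set[OF L] e subLU by blast
qed

end
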